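(* Let $\mathbb{E}(X_i(u))=0$ for all $u\in[a,b]$ and consider the second step of the iterative reconstruction algorithm. Let $X_i^{M_2}(u)$, $u\in M_2$, denote a missing value that is to be reconstructed by $\mathcal{L}(\tilde X_i^{O_2})(u)$ using $\tilde X_i^{O_2}$, which is taken from the reconstruction of the first step. Then the mean squared reconstruction error satisfies $$\mathbb{E}\left(\left(X_i^{M_2}(u)-\mathcal{L}(\tilde X_i^{O_2})(u)\right)^2\right)\le\mathbb{E}\left(\left(X_i^{M_2}(u)-\mathcal{L}(X_i^{O_2})(u)\right)^2\right)+\mathbb{E}\left(\left(X_i^{M_2}(u)-\mathcal{L}(X_i^{O_1})(u)\right)^2\right),$$ where $\mathcal{L}(X_i^{O_1})$ and $\mathcal{L}(X_i^{O_2})$ are the hypothetical reconstructions that would be available if $\gamma$ were fully observed over $[a,b]^2$ and $X_i^{O_2}$ were observable.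
   Context: $X_i$ is a centered continuous random function in $\mathbb{L}^2([a,b])$ with $\mathbb{E}(\|X_i\|_2^4)<\infty$ and continuous covariance function $\gamma(u,v)=\mathbb{E}(X_i(u)X_i(v))$ on $[a,b]^2$. For an interval $O\subseteq[a,b]$ of positive length, $X_i^O$ is the restriction of $X_i$ to $O$, $\langle\cdot,\cdot\rangle_2$ is the inner product of $\mathbb{L}^2(O)$, $(\phi_k^O,\lambda_k^O)_{k\ge1}$ are the orthonormal eigenfunctions and nonzero eigenvalues $\lambda_1^O>\lambda_2^O>\dots>0$ of the integral operator on $\mathbb{L}^2(O)$ with kernel $\gamma|_{O\times O}$, and $\tilde\phi_k^O(u)=\langle\phi_k^O,\gamma(u,\cdot)\rangle_2/\lambda_k^O$ for $u\in[a,b]$. The optimal reconstruction operator based on $O$ is $$\mathcal{L}(X_i^O)(u)=\sum_{k=1}^\infty\langle X_i^O,\phi_k^O\rangle_2\,\tilde\phi_k^O(u),\qquad u\in[a,b];$$ it equals $X_i(u)$ for $u\in O$. The same series, with a (random) function $x^O$ on $O$ in place of $X_i^O$, defines $\mathcal{L}(x^O)(u)$; thus the superscript of the argument indicates the interval whose eigen-elements are used. Iterative reconstruction algorithm (first two steps). First step: $O_1$ is the originally observed interval, $M_1\subseteq[a,b]\setminus O_1$ is the part reconstructed in the first step, and $$\tilde X_{i,1}(u)=\begin{cases}\mathcal{L}(X_i^{O_1})(u)&u\in M_1,\\ X_i^{O_1}(u)&u\in O_1.\end{cases}$$ Second step: one chooses a new "observed" interval $O_2\subset O_1\cup M_1$,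 uses $\tilde X_i^{O_2}(u):=\tilde X_{i,1}(u)$, $u\in O_2$, as the new "observed" fragment, and reconstructs a part $M_2\subseteq[a,b]\setminus O_2$ containing still missing points by $\mathcal{L}(\tilde X_i^{O_2})(u)$, $u\in M_2$. $X_i^{M_2}$ is the restriction of $X_i$ to $M_2$. *)

theory Defs
  imports "HOL-Probability.Probability"
begin

text \<open>
  A random function is a map \<open>X :: 'w \<Rightarrow> real \<Rightarrow> real\<close>, sample point first. Elements of
  \<open>L\<^sup>2(S)\<close> are represented by functions on the reals of which only the values on \<open>S\<close> matter,
  so restriction of a function to \<open>S\<close> is implicit.
\<close>

definition in_l2 :: "real set \<Rightarrow> (real \<Rightarrow> real) \<Rightarrow> bool" where
  "in_l2 S f \<longleftrightarrow>
     set_borel_measurable lborel S f \<and> set_integrable lborel S (\<lambda>t. (f t)\<^sup>2)"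

definition l2_inner :: "real set \<Rightarrow> (real \<Rightarrow> real) \<Rightarrow> (real \<Rightarrow> real) \<Rightarrow> real" where
  "l2_inner S f g = (LINT t:S|lborel. f t * g t)"

definition l2_norm :: "real set \<Rightarrow> (real \<Rightarrow> real) \<Rightarrow> real" where
  "l2_norm S f = sqrt (l2_inner S f f)"

text \<open>The covariance of a centered random function.\<close>

definition cov_fun :: "'w measure \<Rightarrow> ('w \<Rightarrow> real \<Rightarrow> real) \<Rightarrow> real \<Rightarrow> real \<Rightarrow> real" where
  "cov_fun M X u v = (\<integral>\<omega>. X \<omega> u * X \<omega> v \<partial>M)"

definition eigen_eq ::
  "(real \<Rightarrow> real \<Rightarrow> real) \<Rightarrow> real set \<Rightarrow> real \<Rightarrow> (real \<Rightarrow> real) \<Rightarrow> bool" where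
  "eigen_eq \<gamma> S \<mu> f \<longleftrightarrow>
     in_l2 S f \<and> (AE u in lborel. u \<in> S \<longrightarrow> l2_inner S (\<gamma> u) f = \<mu> * f u)"

text \<open>
  The sequences are indexed from \<open>0\<close>, i.e. \<open>\<phi> k\<close> and \<open>lam k\<close> stand for the \<open>(k+1)\<close>-st
  eigenfunction and eigenvalue. The last conjunct says that the list is exhaustive: there are
  no further nonzero eigenvalues and, as the enumeration is strictly decreasing, each listed
  eigenvalue is simple.
\<close>

definition eigensystem ::
  "(real \<Rightarrow> real \<Rightarrow> real) \<Rightarrow> real set \<Rightarrow> (nat \<Rightarrow> real \<Rightarrow> real) \<Rightarrow> (nat \<Rightarrow> real) \<Rightarrow> bool" where
  "eigensystem \<gamma> S \<phi> lam \<longleftrightarrow>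
     (\<forall>k. eigen_eq \<gamma> S (lam k) (\<phi> k)) \<and>
     (\<forall>j k. l2_inner S (\<phi> j) (\<phi> k) = (if j = k then 1 else 0)) \<and>
     (\<forall>k. 0 < lam k \<and> lam (Suc k) < lam k) \<and>
     (\<forall>\<mu> f. \<mu> \<noteq> 0 \<and> eigen_eq \<gamma> S \<mu> f \<and> \<not> (AE t in lborel. t \<in> S \<longrightarrow> f t = 0) \<longrightarrow>
        (\<exists>k c. \<mu> = lam k \<and> (AE t in lborel. t \<in> S \<longrightarrow> f t = c * \<phi> k t)))"

definition phi_ext ::
  "(real \<Rightarrow> real \<Rightarrow> real) \<Rightarrow> real set \<Rightarrow> (nat \<Rightarrow> real \<Rightarrow> real) \<Rightarrow> (nat \<Rightarrow> real) \<Rightarrow>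
   nat \<Rightarrow> real \<Rightarrow> real" where
  "phi_ext \<gamma> S \<phi> lam k u = l2_inner S (\<phi> k) (\<gamma> u) / lam k"

definition recon_sum ::
  "(real \<Rightarrow> real \<Rightarrow> real) \<Rightarrow> real set \<Rightarrow> (nat \<Rightarrow> real \<Rightarrow> real) \<Rightarrow> (nat \<Rightarrow> real) \<Rightarrow>
   ('w \<Rightarrow> real \<Rightarrow> real) \<Rightarrow> nat \<Rightarrow> 'w \<Rightarrow> real \<Rightarrow> real" where
  "recon_sum \<gamma> S \<phi> lam x n \<omega> u =
     (\<Sum>k<n. l2_inner S (x \<omega>) (\<phi> k) * phi_ext \<gamma> S \<phi> lam k u)"

definition ms_limit :: "'w measure \<Rightarrow> (nat \<Rightarrow> 'w \<Rightarrow> real) \<Rightarrow> ('w \<Rightarrow> real) \<Rightarrow> bool" where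
  "ms_limit M S Y \<longleftrightarrow>
     (\<forall>n. S n \<in> borel_measurable M \<and> integrable M (\<lambda>\<omega>. (S n \<omega>)\<^sup>2)) \<and>
     Y \<in> borel_measurable M \<and> integrable M (\<lambda>\<omega>. (Y \<omega>)\<^sup>2) \<and>
     (\<lambda>n. \<integral>\<omega>. (S n \<omega> - Y \<omega>)\<^sup>2 \<partial>M) \<longlonglongrightarrow> 0"

text \<open>
  The reconstruction of a random function \<open>x\<close> on \<open>S\<close>, as a random function on \<open>[a,b]\<close>. The
  series is the limit of its partial sums in mean square, at every \<open>u\<close>: almost sure
  convergence at a fixed \<open>u\<close> is not available, since for general second-order processes the
  scores are merely uncorrelated. A mean-square limit is determined up to a null set for each
  \<open>u\<close>; among its versions one is chosen that is jointly measurable, so that its sample paths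
  can be integrated and the reconstruction can be used as the argument of a further
  reconstruction. The inner products with square-integrable functions and the second moments
  formed from it do not depend, up to null sets, on the version.
\<close>

definition recon ::
  "'w measure \<Rightarrow> real \<Rightarrow> real \<Rightarrow> (real \<Rightarrow> real \<Rightarrow> real) \<Rightarrow>
   real set \<Rightarrow> (nat \<Rightarrow> real \<Rightarrow> real) \<Rightarrow> (nat \<Rightarrow> real) \<Rightarrow>
   ('w \<Rightarrow> real \<Rightarrow> real) \<Rightarrow> 'w \<Rightarrow> real \<Rightarrow> real" where
  "recon M a b \<gamma> S \<phi> lam x =
     (SOME Z. case_prod Z \<in> borel_measurable (M \<Otimes>\<^sub>M lborel) \<and>
        (\<forall>u\<in>{a..b}. ms_limit M (\<lambda>n \<omega>. recon_sum \<gamma> S \<phi> lam x n \<omega> u) (\<lambda>\<omega>. Z \<omega> u)))"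

text \<open>The value \<open>0\<close> off \<open>O1 \<union> M1\<close> is a dummy; the first step produces nothing there.\<close>

definition first_step ::
  "'w measure \<Rightarrow> real \<Rightarrow> real \<Rightarrow> (real \<Rightarrow> real \<Rightarrow> real) \<Rightarrow>
   real set \<Rightarrow> (nat \<Rightarrow> real \<Rightarrow> real) \<Rightarrow> (nat \<Rightarrow> real) \<Rightarrow> real set \<Rightarrow>
   ('w \<Rightarrow> real \<Rightarrow> real) \<Rightarrow> 'w \<Rightarrow> real \<Rightarrow> real" where
  "first_step M a b \<gamma> O1 \<phi> lam M1 X \<omega> u =
     (if u \<in> O1 then X \<omega> u
      else if u \<in> M1 then recon M a b \<gamma> O1 \<phi> lam X \<omega> u
      else 0)"

end

theory Submission
  imports Defs "HOL-Complex_Analysis.Great_Picard"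
begin

text \<open>
  Let \<open>P\<^sub>1\<close> and \<open>P\<^sub>2\<close> be the orthogonal projections of the space of square-integrable random
  variables onto the closed spans of the scores of \<open>X\<close> on \<open>O1\<close> and on \<open>O2\<close>. The
  reconstruction series of \<open>X\<close> from a window is the Fourier expansion of \<open>X(u)\<close> in the scores of
  that window, which are pairwise orthogonal, so the hypothetical reconstructions are \<open>P\<^sub>1 X(u)\<close>
  and \<open>P\<^sub>2 X(u)\<close>. The first step of the algorithm replaces \<open>X(t)\<close> by \<open>P\<^sub>1 X(t)\<close> for
  almost every \<open>t\<close> in \<open>O2\<close>.
  Integration against an eigenfunction commutes with \<open>P\<^sub>1\<close>, hence the scores used in the second
  step are the \<open>P\<^sub>1\<close>-images of the true scores on \<open>O2\<close>, and the second step yields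
  \<open>P\<^sub>1 P\<^sub>2 X(u)\<close>. By Pythagoras,
  \<open>\<parallel>X(u) - P\<^sub>1 P\<^sub>2 X(u)\<parallel>\<^sup>2 = \<parallel>X(u) - P\<^sub>1 X(u)\<parallel>\<^sup>2 + \<parallel>P\<^sub>1 (X(u) - P\<^sub>2 X(u))\<parallel>\<^sup>2\<close>, and \<open>P\<^sub>1\<close> is a
  contraction. The bound is \<open>orth_projection_error_le\<close>, applied to partial sums.

  Two points need work. The first is that \<open>P\<^sub>1 X(t) = X(t)\<close> for almost every \<open>t\<close> in \<open>O1\<close>
  (\<open>scores_complete\<close>). It amounts to the statement that a function orthogonal to all
  eigenfunctions is annihilated by the covariance operator, i.e. to the spectral theorem for compact
  symmetric operators (\<open>integral_op_zero_of_orthogonal_eigensystem\<close>). That is proved by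
  power iteration: the normalised iterates of a function that is not annihilated subconverge, by
  the theorem of Arzela and Ascoli, to an eigenfunction of the squared operator, and this
  eigenfunction inherits the orthogonality, in contradiction to the completeness of the list of
  eigenfunctions.

  The second is that the reconstructions exist, as jointly measurable functions of the sample point
  and of \<open>u\<close> that are mean-square limits for every single \<open>u\<close>
  (\<open>ex_jointly_measurable_ms_limit\<close>). Completeness of the space of square-integrable variables is
  proved there together with measurability in the parameter, by extracting for each \<open>u\<close> a
  subsequence whose indices depend measurably on \<open>u\<close>.
\<close>

section \<open>Square-integrable functions\<close>

definition square_integrable :: "'a measure \<Rightarrow> ('a \<Rightarrow> real) \<Rightarrow> bool" where
  "square_integrable M f \<longleftrightarrow> f \<in> borel_measurable M \<and> integrable M (\<lambda>x. (f x)\<^sup>2)"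

lemma integrable_mult_square_integrable:
  assumes "square_integrable M f" "square_integrable M g"
  shows "integrable M (\<lambda>x. f x * g x)"
proof (rule Bochner_Integration.integrable_bound)
  show "integrable M (\<lambda>x. (f x)\<^sup>2 + (g x)\<^sup>2)"
    using assms by (auto simp: square_integrable_def)
  show "(\<lambda>x. f x * g x) \<in> borel_measurable M"
    using assms by (auto simp: square_integrable_def)
  have "\<bar>p * q\<bar> \<le> p\<^sup>2 + q\<^sup>2" for p q :: real
  proof -
    have "2 * \<bar>p\<bar> * \<bar>q\<bar> \<le> p\<^sup>2 + q\<^sup>2" using sum_squares_bound[of "\<bar>p\<bar>" "\<bar>q\<bar>"] by simp
    moreover have "0 \<le> \<bar>p\<bar> * \<bar>q\<bar>" by simp
    ultimately show ?thesis unfolding abs_mult by linarith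
  qed
  then show "AE x in M. norm (f x * g x) \<le> norm ((f x)\<^sup>2 + (g x)\<^sup>2)"
    by simp
qed

lemma square_integrable_add:
  assumes "square_integrable M f" "square_integrable M g"
  shows "square_integrable M (\<lambda>x. f x + g x)"
  using assms integrable_mult_square_integrable[OF assms]
  by (auto simp: square_integrable_def power2_sum mult.assoc)

lemma square_integrable_scale:
  assumes "square_integrable M f"
  shows "square_integrable M (\<lambda>x. c * f x)"
  using assms by (auto simp: square_integrable_def power_mult_distrib)

lemma square_integrable_diff:
  assumes "square_integrable M f" "square_integrable M g"
  shows "square_integrable M (\<lambda>x. f x - g x)"
  using square_integrable_add[OF assms(1) square_integrable_scale[OF assms(2), of "-1"]] by simp

lemma square_integrable_sum:
  assumes "\<And>i. i \<in> I \<Longrightarrow> square_integrable M (f i)"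
  shows "square_integrable M (\<lambda>x. \<Sum>i\<in>I. f i x)"
  using assms
proof (induction I rule: infinite_finite_induct)
  case (insert i I)
  then show ?case by (simp add: square_integrable_add)
qed (simp_all add: square_integrable_def)

lemma integral_square_add:
  assumes "square_integrable M f" "square_integrable M g"
  shows "(\<integral>x. (f x + g x)\<^sup>2 \<partial>M) = (\<integral>x. (f x)\<^sup>2 \<partial>M) + 2 * (\<integral>x. f x * g x \<partial>M) + (\<integral>x. (g x)\<^sup>2 \<partial>M)"
  using assms integrable_mult_square_integrable[OF assms]
  by (simp add: power2_sum square_integrable_def mult.assoc)

lemma integral_square_diff:
  assumes "square_integrable M f" "square_integrable M g"
  shows "(\<integral>x. (f x - g x)\<^sup>2 \<partial>M) = (\<integral>x. (f x)\<^sup>2 \<partial>M) - 2 * (\<integral>x. f x * g x \<partial>M) + (\<integral>x. (g x)\<^sup>2 \<partial>M)"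
  using assms integrable_mult_square_integrable[OF assms]
  by (simp add: power2_diff square_integrable_def mult.assoc)

lemma integral_Cauchy_Schwarz:
  assumes f: "square_integrable M f" and g: "square_integrable M g"
  shows "(\<integral>x. f x * g x \<partial>M)\<^sup>2 \<le> (\<integral>x. (f x)\<^sup>2 \<partial>M) * (\<integral>x. (g x)\<^sup>2 \<partial>M)"
proof -
  define A B C where "A = (\<integral>x. (f x)\<^sup>2 \<partial>M)" "B = (\<integral>x. f x * g x \<partial>M)" "C = (\<integral>x. (g x)\<^sup>2 \<partial>M)"
  have "0 \<le> A - 2 * (t * B) + t\<^sup>2 * C" for t
  proof -
    have "0 \<le> (\<integral>x. (f x - t * g x)\<^sup>2 \<partial>M)" by simp
    also have "\<dots> = A - 2 * (t * B) + t\<^sup>2 * C"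
      by (simp add: integral_square_diff[OF f square_integrable_scale[OF g]] A_B_C_def
          power_mult_distrib mult.left_commute[of _ t])
    finally show ?thesis .
  qed
  note q = this
  have "0 \<le> C" by (simp add: A_B_C_def)
  show ?thesis
  proof (cases "C = 0")
    case True
    have "B = 0"
    proof (rule ccontr)
      assume "B \<noteq> 0"
      \<comment> \<open>With \<open>C = 0\<close> the quadratic is affine in \<open>t\<close>; this \<open>t\<close> makes it equal to \<open>-1\<close>.\<close>
      have "0 \<le> A - 2 * ((A + 1) / (2 * B) * B)" using q[of "(A + 1) / (2 * B)"] True by simp
      with \<open>B \<noteq> 0\<close> show False by simp
    qed
    then show ?thesis using True by (simp add: A_B_C_def)
  next
    case False
    with \<open>0 \<le> C\<close> have "0 < C" by simp
    \<comment> \<open>The vertex of the parabola.\<close>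
    have "0 \<le> (A - 2 * (B / C * B) + (B / C)\<^sup>2 * C) * C"
      using q[of "B / C"] \<open>0 < C\<close> by simp
    also have "\<dots> = A * C - B\<^sup>2" using \<open>0 < C\<close> by (simp add: field_simps power2_eq_square)
    finally show ?thesis by (simp add: A_B_C_def)
  qed
qed

lemma abs_integral_mult_le:
  assumes f: "square_integrable M f" and g: "square_integrable M g"
  shows "\<bar>\<integral>x. f x * g x \<partial>M\<bar> \<le> sqrt (\<integral>x. (f x)\<^sup>2 \<partial>M) * sqrt (\<integral>x. (g x)\<^sup>2 \<partial>M)"
  using real_sqrt_le_mono[OF integral_Cauchy_Schwarz[OF assms]] by (simp add: real_sqrt_mult)

lemma (in finite_measure) square_integrable_bounded:
  assumes "f \<in> borel_measurable M" "\<And>x. x \<in> space M \<Longrightarrow> \<bar>f x\<bar> \<le> K"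
  shows "square_integrable M f"
proof -
  have "(f x)\<^sup>2 \<le> K\<^sup>2" if "x \<in> space M" for x
    using assms(2)[OF that] by (simp add: abs_le_square_iff[symmetric])
  then show ?thesis
    using assms(1) by (auto simp: square_integrable_def intro!: integrable_const_bound[where B = "K\<^sup>2"])
qed

lemma (in finite_measure) integrable_square_integrable:
  assumes "square_integrable M f" shows "integrable M f"
  using integrable_mult_square_integrable[OF assms, of "\<lambda>_. 1"] by (simp add: square_integrable_def)

lemma square_integrable_pairI:
  assumes "sigma_finite_measure M" "finite_measure N"
    and x [measurable]: "case_prod x \<in> borel_measurable (M \<Otimes>\<^sub>M N)"
    and int: "\<And>t. t \<in> space N \<Longrightarrow> integrable M (\<lambda>\<omega>. (x \<omega> t)\<^sup>2)"
    and le: "\<And>t. t \<in> space N \<Longrightarrow> (\<integral>\<omega>. (x \<omega> t)\<^sup>2 \<partial>M) \<le> K"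
  shows "square_integrable (M \<Otimes>\<^sub>M N) (case_prod x)"
proof -
  interpret M: sigma_finite_measure M by fact
  interpret N: finite_measure N by fact
  interpret pair_sigma_finite M N ..
  have x' [measurable]: "(\<lambda>p. x (fst p) (snd p)) \<in> borel_measurable (M \<Otimes>\<^sub>M N)"
    using x by (simp add: split_beta)
  have "(\<integral>\<^sup>+p. ennreal ((x (fst p) (snd p))\<^sup>2) \<partial>(M \<Otimes>\<^sub>M N))
      = (\<integral>\<^sup>+t. \<integral>\<^sup>+\<omega>. ennreal ((x \<omega> t)\<^sup>2) \<partial>M \<partial>N)"
    by (subst nn_integral_snd[symmetric]) (simp_all add: split_beta)
  also have "\<dots> \<le> (\<integral>\<^sup>+t. ennreal K \<partial>N)"
    using int le by (intro nn_integral_mono) (simp add: nn_integral_eq_integral ennreal_leI)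
  also have "\<dots> < \<infinity>" by (simp add: ennreal_mult_less_top N.emeasure_eq_measure)
  finally have "integrable (M \<Otimes>\<^sub>M N) (\<lambda>p. (x (fst p) (snd p))\<^sup>2)"
    by (intro integrableI_bounded) auto
  then show ?thesis by (simp add: square_integrable_def split_beta)
qed

text \<open>
  By Cauchy-Schwarz on each path, \<open>(\<integral>t. x \<omega> t * \<phi> t \<partial>N)\<^sup>2\<close> is at most the squared norm of \<open>\<phi>\<close> times
  that of the path, and the latter is integrable by Fubini.
\<close>

lemma square_integrable_integral_mult:
  assumes "sigma_finite_measure M" "sigma_finite_measure N"
    and x: "square_integrable (M \<Otimes>\<^sub>M N) (case_prod x)" and \<phi>: "square_integrable N \<phi>"
  shows "square_integrable M (\<lambda>\<omega>. \<integral>t. x \<omega> t * \<phi> t \<partial>N)"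
proof -
  interpret M: sigma_finite_measure M by fact
  interpret N: sigma_finite_measure N by fact
  interpret pair_sigma_finite M N ..
  have xm [measurable]: "case_prod x \<in> borel_measurable (M \<Otimes>\<^sub>M N)"
    and [measurable]: "\<phi> \<in> borel_measurable N"
    using x \<phi> by (auto simp: square_integrable_def)
  have xm' [measurable]: "(\<lambda>p. x (fst p) (snd p)) \<in> borel_measurable (M \<Otimes>\<^sub>M N)"
    using xm by (simp add: split_beta)
  have int: "integrable (M \<Otimes>\<^sub>M N) (\<lambda>(\<omega>, t). (x \<omega> t)\<^sup>2)"
    using x by (simp add: square_integrable_def case_prod_unfold)
  have m: "(\<lambda>\<omega>. \<integral>t. x \<omega> t * \<phi> t \<partial>N) \<in> borel_measurable M"
    by (rule N.borel_measurable_lebesgue_integral) (simp add: split_beta)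
  have "integrable M (\<lambda>\<omega>. (\<integral>t. x \<omega> t * \<phi> t \<partial>N)\<^sup>2)"
  proof (rule Bochner_Integration.integrable_bound)
    show "integrable M (\<lambda>\<omega>. (\<integral>t. (x \<omega> t)\<^sup>2 \<partial>N) * (\<integral>t. (\<phi> t)\<^sup>2 \<partial>N))"
      using integrable_fst[OF int] by simp
    show "AE \<omega> in M. norm ((\<integral>t. x \<omega> t * \<phi> t \<partial>N)\<^sup>2)
        \<le> norm ((\<integral>t. (x \<omega> t)\<^sup>2 \<partial>N) * (\<integral>t. (\<phi> t)\<^sup>2 \<partial>N))"
      using AE_integrable_fst[OF int] AE_space
    proof eventually_elim
      case (elim \<omega>)
      have "(\<lambda>t. x \<omega> t) \<in> borel_measurable N"
        using measurable_compose[OF measurable_Pair1'[OF elim(2)] xm] by simp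
      then have "square_integrable N (x \<omega>)" using elim by (simp add: square_integrable_def)
      from integral_Cauchy_Schwarz[OF this \<phi>] show ?case by simp
    qed
  qed (use m in measurable)
  with m show ?thesis by (simp add: square_integrable_def)
qed

text \<open>
  Taking scores commutes with taking inner products against a random variable. The kernel of an
  integral operator is another instance of \<open>x\<close>, with both measures equal; there the identity says
  that the adjoint has the transposed kernel.
\<close>

lemma integral_integral_mult_swap:
  assumes "sigma_finite_measure M" "sigma_finite_measure N"
    and x: "square_integrable (M \<Otimes>\<^sub>M N) (case_prod x)"
    and \<phi>: "square_integrable N \<phi>" and W: "square_integrable M W"
  shows "(\<integral>\<omega>. (\<integral>t. x \<omega> t * \<phi> t \<partial>N) * W \<omega> \<partial>M) = (\<integral>t. (\<integral>\<omega>. x \<omega> t * W \<omega> \<partial>M) * \<phi> t \<partial>N)"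
proof -
  interpret M: sigma_finite_measure M by fact
  interpret N: sigma_finite_measure N by fact
  interpret pair_sigma_finite M N ..
  have [measurable]: "\<phi> \<in> borel_measurable N" "W \<in> borel_measurable M"
    using \<phi> W by (auto simp: square_integrable_def)
  have "integrable (M \<Otimes>\<^sub>M N) (\<lambda>p. (W (fst p))\<^sup>2 * (\<phi> (snd p))\<^sup>2)"
  proof (rule Fubini_integrable)
    show "integrable M (\<lambda>\<omega>. \<integral>t. norm ((W (fst (\<omega>, t)))\<^sup>2 * (\<phi> (snd (\<omega>, t)))\<^sup>2) \<partial>N)"
      using W \<phi> by (simp add: abs_mult square_integrable_def)
    show "AE \<omega> in M. integrable N (\<lambda>t. (W (fst (\<omega>, t)))\<^sup>2 * (\<phi> (snd (\<omega>, t)))\<^sup>2)"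
      using \<phi> by (simp add: square_integrable_def)
  qed measurable
  then have "square_integrable (M \<Otimes>\<^sub>M N) (\<lambda>p. W (fst p) * \<phi> (snd p))"
    by (simp add: square_integrable_def power_mult_distrib)
  from integrable_mult_square_integrable[OF x this]
  have int: "integrable (M \<Otimes>\<^sub>M N) (\<lambda>(\<omega>, t). x \<omega> t * \<phi> t * W \<omega>)"
    by (simp add: case_prod_unfold mult.assoc mult.commute[of "W _"])
  have "(\<integral>\<omega>. (\<integral>t. x \<omega> t * \<phi> t \<partial>N) * W \<omega> \<partial>M) = (\<integral>\<omega>. (\<integral>t. x \<omega> t * \<phi> t * W \<omega> \<partial>N) \<partial>M)"
    by simp
  also have "\<dots> = (\<integral>t. (\<integral>\<omega>. x \<omega> t * \<phi> t * W \<omega> \<partial>M) \<partial>N)"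
    by (rule Fubini_integral[OF int, symmetric])
  also have "\<dots> = (\<integral>t. (\<integral>\<omega>. x \<omega> t * W \<omega> * \<phi> t \<partial>M) \<partial>N)"
    by (simp add: ac_simps)
  finally show ?thesis by simp
qed

section \<open>Mean-square limits\<close>

lemma ms_limit_square_integrable:
  assumes "ms_limit M S Y"
  shows "square_integrable M (S n)" "square_integrable M Y"
  using assms by (auto simp: ms_limit_def square_integrable_def)

lemma ms_limit_inner:
  assumes S: "ms_limit M S Y" and W: "square_integrable M W"
  shows "(\<lambda>n. \<integral>x. S n x * W x \<partial>M) \<longlonglongrightarrow> (\<integral>x. Y x * W x \<partial>M)"
proof (rule LIM_zero_cancel, rule Lim_null_comparison)
  note [simp] = ms_limit_square_integrable[OF S] W
  have "\<bar>(\<integral>x. S n x * W x \<partial>M) - (\<integral>x. Y x * W x \<partial>M)\<bar>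
      \<le> sqrt (\<integral>x. (S n x - Y x)\<^sup>2 \<partial>M) * sqrt (\<integral>x. (W x)\<^sup>2 \<partial>M)" for n
  proof -
    have "(\<integral>x. S n x * W x \<partial>M) - (\<integral>x. Y x * W x \<partial>M) = (\<integral>x. (S n x - Y x) * W x \<partial>M)"
      by (simp add: left_diff_distrib integrable_mult_square_integrable)
    then show ?thesis
      using abs_integral_mult_le[OF square_integrable_diff W, of "S n" Y] by simp
  qed
  then show "\<forall>\<^sub>F n in sequentially. norm ((\<integral>x. S n x * W x \<partial>M) - (\<integral>x. Y x * W x \<partial>M))
      \<le> sqrt (\<integral>x. (S n x - Y x)\<^sup>2 \<partial>M) * sqrt (\<integral>x. (W x)\<^sup>2 \<partial>M)"
    by simp
  have "(\<lambda>n. \<integral>x. (S n x - Y x)\<^sup>2 \<partial>M) \<longlonglongrightarrow> 0" using S by (simp add: ms_limit_def)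
  then show "(\<lambda>n. sqrt (\<integral>x. (S n x - Y x)\<^sup>2 \<partial>M) * sqrt (\<integral>x. (W x)\<^sup>2 \<partial>M)) \<longlonglongrightarrow> 0"
    by (intro tendsto_mult_left_zero) (use tendsto_real_sqrt in fastforce)
qed

text \<open>
  Expand around the limit: the mixed term tends to zero by weak convergence.
\<close>

lemma ms_limit_distance:
  assumes S: "ms_limit M S Y" and V: "square_integrable M V"
  shows "(\<lambda>n. \<integral>x. (V x - S n x)\<^sup>2 \<partial>M) \<longlonglongrightarrow> (\<integral>x. (V x - Y x)\<^sup>2 \<partial>M)"
proof -
  note [simp] = ms_limit_square_integrable[OF S] V
  have VY [simp]: "square_integrable M (\<lambda>x. V x - Y x)" by (rule square_integrable_diff) simp_all
  have "(\<lambda>n. \<integral>x. (S n x - Y x)\<^sup>2 \<partial>M) \<longlonglongrightarrow> 0" using S by (simp add: ms_limit_def)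
  moreover have "(\<lambda>n. (\<integral>x. S n x * (V x - Y x) \<partial>M) - (\<integral>x. Y x * (V x - Y x) \<partial>M)) \<longlonglongrightarrow> 0"
    using ms_limit_inner[OF S VY] by (rule LIM_zero)
  ultimately have "(\<lambda>n. (\<integral>x. (V x - Y x)\<^sup>2 \<partial>M)
      - 2 * ((\<integral>x. S n x * (V x - Y x) \<partial>M) - (\<integral>x. Y x * (V x - Y x) \<partial>M))
      + (\<integral>x. (S n x - Y x)\<^sup>2 \<partial>M)) \<longlonglongrightarrow> (\<integral>x. (V x - Y x)\<^sup>2 \<partial>M) - 2 * 0 + 0"
    by (intro tendsto_intros)
  moreover have "(\<integral>x. (V x - S n x)\<^sup>2 \<partial>M) = (\<integral>x. (V x - Y x)\<^sup>2 \<partial>M)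
      - 2 * ((\<integral>x. S n x * (V x - Y x) \<partial>M) - (\<integral>x. Y x * (V x - Y x) \<partial>M))
      + (\<integral>x. (S n x - Y x)\<^sup>2 \<partial>M)" for n
  proof -
    have "(\<integral>x. (V x - S n x)\<^sup>2 \<partial>M) = (\<integral>x. ((V x - Y x) - (S n x - Y x))\<^sup>2 \<partial>M)" by simp
    also have "\<dots> = (\<integral>x. (V x - Y x)\<^sup>2 \<partial>M) - 2 * (\<integral>x. (V x - Y x) * (S n x - Y x) \<partial>M)
        + (\<integral>x. (S n x - Y x)\<^sup>2 \<partial>M)"
      by (intro integral_square_diff VY square_integrable_diff) simp_all
    also have "(\<integral>x. (V x - Y x) * (S n x - Y x) \<partial>M)
        = (\<integral>x. S n x * (V x - Y x) - Y x * (V x - Y x) \<partial>M)"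
      by (simp add: algebra_simps)
    also have "\<dots> = (\<integral>x. S n x * (V x - Y x) \<partial>M) - (\<integral>x. Y x * (V x - Y x) \<partial>M)"
      by (intro Bochner_Integration.integral_diff integrable_mult_square_integrable) simp_all
    finally show ?thesis .
  qed
  ultimately show ?thesis by simp
qed

lemma ms_limit_diff:
  assumes "ms_limit M S Y" "ms_limit M S' Y'"
  shows "ms_limit M (\<lambda>n x. S n x - S' n x) (\<lambda>x. Y x - Y' x)"
proof -
  note q = ms_limit_square_integrable[OF assms(1)] ms_limit_square_integrable[OF assms(2)]
  have d: "square_integrable M (\<lambda>x. S n x - Y x)" "square_integrable M (\<lambda>x. S' n x - Y' x)" for n
    using q square_integrable_diff by blast+
  have square_diff: "(p - q)\<^sup>2 \<le> 2 * p\<^sup>2 + 2 * q\<^sup>2" for p q :: real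
    using zero_le_power2[of "p + q"] by (simp add: power2_sum power2_diff)
  have "(\<lambda>n. \<integral>x. (S n x - S' n x - (Y x - Y' x))\<^sup>2 \<partial>M) \<longlonglongrightarrow> 0"
  proof (rule tendsto_sandwich[where f = "\<lambda>_. 0"])
    have "(\<integral>x. (S n x - S' n x - (Y x - Y' x))\<^sup>2 \<partial>M)
        \<le> 2 * (\<integral>x. (S n x - Y x)\<^sup>2 \<partial>M) + 2 * (\<integral>x. (S' n x - Y' x)\<^sup>2 \<partial>M)" for n
    proof -
      have "(\<integral>x. (S n x - S' n x - (Y x - Y' x))\<^sup>2 \<partial>M)
          \<le> (\<integral>x. 2 * (S n x - Y x)\<^sup>2 + 2 * (S' n x - Y' x)\<^sup>2 \<partial>M)"
      proof (rule integral_mono)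
        have e: "S n x - S' n x - (Y x - Y' x) = (S n x - Y x) - (S' n x - Y' x)" for x by simp
        show "integrable M (\<lambda>x. (S n x - S' n x - (Y x - Y' x))\<^sup>2)"
          unfolding e using square_integrable_diff[OF d, of n n] by (simp add: square_integrable_def)
        show "(S n x - S' n x - (Y x - Y' x))\<^sup>2 \<le> 2 * (S n x - Y x)\<^sup>2 + 2 * (S' n x - Y' x)\<^sup>2" for x
        unfolding e by (rule square_diff)
      qed (use d in \<open>simp add: square_integrable_def\<close>)
      also have "\<dots> = 2 * (\<integral>x. (S n x - Y x)\<^sup>2 \<partial>M) + 2 * (\<integral>x. (S' n x - Y' x)\<^sup>2 \<partial>M)"
        using d[of n] by (simp add: square_integrable_def)
      finally show ?thesis .
    qed
    then show "\<forall>\<^sub>F n in sequentially. (\<integral>x. (S n x - S' n x - (Y x - Y' x))\<^sup>2 \<partial>M)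
        \<le> 2 * (\<integral>x. (S n x - Y x)\<^sup>2 \<partial>M) + 2 * (\<integral>x. (S' n x - Y' x)\<^sup>2 \<partial>M)"
      by simp
    have "(\<lambda>n. 2 * (\<integral>x. (S n x - Y x)\<^sup>2 \<partial>M) + 2 * (\<integral>x. (S' n x - Y' x)\<^sup>2 \<partial>M)) \<longlonglongrightarrow> 2 * 0 + 2 * 0"
      using assms by (intro tendsto_intros) (auto simp: ms_limit_def)
    then show "(\<lambda>n. 2 * (\<integral>x. (S n x - Y x)\<^sup>2 \<partial>M) + 2 * (\<integral>x. (S' n x - Y' x)\<^sup>2 \<partial>M)) \<longlonglongrightarrow> 0"
      by simp
  qed simp_all
  then show ?thesis
    using square_integrable_diff[OF q(1,3)] square_integrable_diff[OF q(2,4)]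
    by (simp add: ms_limit_def square_integrable_def)
qed

lemma ms_limit_scale:
  assumes "ms_limit M S Y"
  shows "ms_limit M (\<lambda>n x. c * S n x) (\<lambda>x. c * Y x)"
proof -
  have "(\<lambda>n. c\<^sup>2 * (\<integral>x. (S n x - Y x)\<^sup>2 \<partial>M)) \<longlonglongrightarrow> 0"
    using assms by (intro tendsto_mult_right_zero) (simp add: ms_limit_def)
  then show ?thesis
    using square_integrable_scale[OF ms_limit_square_integrable(1)[OF assms]]
      square_integrable_scale[OF ms_limit_square_integrable(2)[OF assms]]
    by (simp add: ms_limit_def square_integrable_def power_mult_distrib right_diff_distrib[symmetric])
qed

lemma (in finite_measure) ms_limit_of_uniform:
  assumes q: "\<And>n. square_integrable M (S n)" "square_integrable M Y"
    and lim: "\<And>n x. x \<in> space M \<Longrightarrow> \<bar>S n x - Y x\<bar> \<le> e n" "e \<longlonglongrightarrow> 0"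
  shows "ms_limit M S Y"
proof -
  have "(\<lambda>n. \<integral>x. (S n x - Y x)\<^sup>2 \<partial>M) \<longlonglongrightarrow> 0"
  proof (rule tendsto_sandwich[where f = "\<lambda>_. 0"])
    have "(\<integral>x. (S n x - Y x)\<^sup>2 \<partial>M) \<le> (\<integral>x. (e n)\<^sup>2 \<partial>M)" for n
    proof (rule integral_mono)
      show "integrable M (\<lambda>x. (S n x - Y x)\<^sup>2)"
        using square_integrable_diff[OF q(1)[of n] q(2)] by (simp add: square_integrable_def)
      show "(S n x - Y x)\<^sup>2 \<le> (e n)\<^sup>2" if "x \<in> space M" for x
        using lim(1)[OF that, of n] by (auto simp: abs_le_square_iff[symmetric])
    qed simp
    then show "\<forall>\<^sub>F n in sequentially. (\<integral>x. (S n x - Y x)\<^sup>2 \<partial>M) \<le> (e n)\<^sup>2 * measure M (space M)"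
      by (simp add: mult.commute)
    show "(\<lambda>n. (e n)\<^sup>2 * measure M (space M)) \<longlonglongrightarrow> 0"
      using tendsto_power[OF lim(2), of 2] by (intro tendsto_mult_left_zero) simp
  qed simp_all
  then show ?thesis using q by (simp add: ms_limit_def square_integrable_def)
qed

text \<open>
  The Borel-Cantelli type step in the completeness proof: increments with summable first moments
  are almost surely summable, since the expected sum of their absolute values is finite.
\<close>

lemma AE_summable_of_nn_integral:
  fixes d :: "nat \<Rightarrow> 'a \<Rightarrow> real"
  assumes [measurable]: "\<And>j. d j \<in> borel_measurable M"
    and le: "\<And>j. (\<integral>\<^sup>+x. ennreal \<bar>d j x\<bar> \<partial>M) \<le> ennreal (c j)"
    and c: "\<And>j. 0 \<le> c j" "summable c"
  shows "AE x in M. summable (\<lambda>j. d j x)"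
proof -
  have "(\<integral>\<^sup>+x. (\<Sum>j. ennreal \<bar>d j x\<bar>) \<partial>M) = (\<Sum>j. \<integral>\<^sup>+x. ennreal \<bar>d j x\<bar> \<partial>M)"
    by (rule nn_integral_suminf) simp
  also have "\<dots> \<le> (\<Sum>j. ennreal (c j))"
    by (intro suminf_le le) auto
  also have "\<dots> = ennreal (suminf c)" using c by (simp add: suminf_ennreal2)
  finally have "(\<integral>\<^sup>+x. (\<Sum>j. ennreal \<bar>d j x\<bar>) \<partial>M) \<noteq> \<infinity>"
    by (auto simp: top_unique)
  then have "AE x in M. (\<Sum>j. ennreal \<bar>d j x\<bar>) \<noteq> \<infinity>"
    by (intro nn_integral_PInf_AE) auto
  then show ?thesis
  proof eventually_elim
    case (elim x)
    then have "summable (\<lambda>j. \<bar>d j x\<bar>)" by (intro summable_suminf_not_top) auto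
    then show ?case by (rule summable_rabs_cancel)
  qed
qed

lemma (in prob_space) nn_integral_abs_le_of_square:
  assumes "square_integrable M f" "(\<integral>x. (f x)\<^sup>2 \<partial>M) \<le> c\<^sup>2" "0 \<le> c"
  shows "(\<integral>\<^sup>+x. ennreal \<bar>f x\<bar> \<partial>M) \<le> ennreal c"
proof -
  have f: "integrable M f" using assms(1) by (rule integrable_square_integrable)
  have 1: "square_integrable M (\<lambda>x. \<bar>f x\<bar>)" "square_integrable M (\<lambda>_. 1)"
    using assms(1) by (auto simp: square_integrable_def)
  have "(\<integral>x. \<bar>f x\<bar> * 1 \<partial>M)\<^sup>2 \<le> (\<integral>x. \<bar>f x\<bar>\<^sup>2 \<partial>M) * (\<integral>x. 1\<^sup>2 \<partial>M)"
    by (rule integral_Cauchy_Schwarz[OF 1])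
  also have "\<dots> \<le> c\<^sup>2" using assms(2) by (simp add: prob_space)
  finally have "(\<integral>x. \<bar>f x\<bar> \<partial>M) \<le> c" using assms(3) by (simp add: power2_le_iff_abs_le)
  then show ?thesis using f by (simp add: nn_integral_eq_integral ennreal_leI)
qed

text \<open>
  For fixed \<open>u\<close> this is the Riesz-Fischer argument: along indices \<open>K j u\<close> at which the sequence is
  Cauchy up to \<open>4\<^sup>-\<^sup>j\<close> it converges almost surely, and by Fatou the pointwise limit is also the
  mean-square limit. A limit in the product space would only settle almost every \<open>u\<close>; making the
  choice of the subsequence measurable in \<open>u\<close> gives a single function that is good for every \<open>u\<close>.
\<close>

lemma (in prob_space) ex_jointly_measurable_ms_limit:
  fixes S :: "nat \<Rightarrow> 'a \<Rightarrow> real \<Rightarrow> real"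
  assumes S [measurable]: "\<And>n. case_prod (S n) \<in> borel_measurable (M \<Otimes>\<^sub>M lborel)"
    and sq: "\<And>n u. u \<in> A \<Longrightarrow> integrable M (\<lambda>\<omega>. (S n \<omega> u)\<^sup>2)"
    and Cauchy: "\<And>u e. u \<in> A \<Longrightarrow> 0 < e \<Longrightarrow>
      \<exists>N. \<forall>m\<ge>N. \<forall>n\<ge>N. (\<integral>\<omega>. (S m \<omega> u - S n \<omega> u)\<^sup>2 \<partial>M) < e"
  shows "\<exists>Z. case_prod Z \<in> borel_measurable (M \<Otimes>\<^sub>M lborel) \<and>
      (\<forall>u\<in>A. ms_limit M (\<lambda>n \<omega>. S n \<omega> u) (\<lambda>\<omega>. Z \<omega> u))"
proof -
  define D where "D m n u = (\<integral>\<omega>. (S m \<omega> u - S n \<omega> u)\<^sup>2 \<partial>M)" for m n u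
  \<comment> \<open>The index reached depends on \<open>u\<close>, but measurably, being a least element cut out by the
    measurable functions \<open>D m n\<close>.\<close>
  define K where "K j u = (LEAST N. \<forall>m\<ge>N. \<forall>n\<ge>N. D m n u < ((1/2) ^ j)\<^sup>2)" for j :: nat and u
  define Z where "Z \<omega> u = lim (\<lambda>j. S (K j u) \<omega> u)" for \<omega> u
  have S' [measurable]: "(\<lambda>p. S n (snd p) (fst p)) \<in> borel_measurable (lborel \<Otimes>\<^sub>M M)" for n
    using measurable_compose[OF measurable_pair_swap' S[of n]] by (simp add: split_beta)
  have S'' [measurable]: "(\<lambda>p. S n (fst p) (snd p)) \<in> borel_measurable (M \<Otimes>\<^sub>M lborel)" for n
    using S[of n] by (simp add: split_beta)
  have [measurable]: "D m n \<in> borel_measurable lborel" for m n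
    unfolding D_def by (rule borel_measurable_lebesgue_integral) (simp add: split_beta, measurable)
  have [measurable]: "K j \<in> measurable lborel (count_space UNIV)" for j
    unfolding K_def by measurable
  have Zm: "case_prod Z \<in> borel_measurable (M \<Otimes>\<^sub>M lborel)"
    unfolding Z_def split_beta
    by (rule borel_measurable_lim_metric,
        rule measurable_compose_countable[where g = "\<lambda>p. K _ (snd p)"]) measurable
  have "ms_limit M (\<lambda>n \<omega>. S n \<omega> u) (\<lambda>\<omega>. Z \<omega> u)" if u: "u \<in> A" for u
  proof -
    have Sm [measurable]: "(\<lambda>\<omega>. S n \<omega> u) \<in> borel_measurable M" for n
      using measurable_compose[OF measurable_Pair2' S[of n], of u] by simp
    have Zu [measurable]: "(\<lambda>\<omega>. Z \<omega> u) \<in> borel_measurable M"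
      using measurable_compose[OF measurable_Pair2' Zm, of u] by simp
    have Sq: "square_integrable M (\<lambda>\<omega>. S n \<omega> u)" for n
      using sq[OF u] by (simp add: square_integrable_def)
    have dq: "square_integrable M (\<lambda>\<omega>. S m \<omega> u - S n \<omega> u)" for m n
      by (rule square_integrable_diff[OF Sq Sq])
    have K: "\<forall>m\<ge>K j u. \<forall>n\<ge>K j u. D m n u < ((1/2) ^ j)\<^sup>2" for j
      unfolding K_def by (rule LeastI_ex) (use Cauchy[OF u, of "((1/2) ^ j)\<^sup>2"] in \<open>simp add: D_def\<close>)
    have K_mono: "K i u \<le> K j u" if "i \<le> j" for i j
    proof -
      have "((1/2::real) ^ j)\<^sup>2 \<le> ((1/2) ^ i)\<^sup>2"
        using that by (intro power_mono power_decreasing) auto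
      with K[of j] have "\<forall>m\<ge>K j u. \<forall>n\<ge>K j u. D m n u < ((1/2) ^ i)\<^sup>2"
        by (meson less_le_trans)
      then show ?thesis unfolding K_def[of i] by (rule Least_le)
    qed
    have "AE \<omega> in M. summable (\<lambda>j. S (K (Suc j) u) \<omega> u - S (K j u) \<omega> u)"
    proof (rule AE_summable_of_nn_integral[where c = "\<lambda>j. (1/2) ^ j"])
      show "(\<integral>\<^sup>+\<omega>. ennreal \<bar>S (K (Suc j) u) \<omega> u - S (K j u) \<omega> u\<bar> \<partial>M) \<le> ennreal ((1/2) ^ j)" for j
        using K[of j] K_mono[of j "Suc j"]
        by (intro nn_integral_abs_le_of_square dq) (auto simp: D_def intro: less_imp_le)
    qed (auto intro: summable_geometric)
    then have conv: "AE \<omega> in M. (\<lambda>j. S (K j u) \<omega> u) \<longlonglongrightarrow> Z \<omega> u"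
    proof eventually_elim
      case (elim \<omega>)
      then have "convergent (\<lambda>n. \<Sum>j<n. S (K (Suc j) u) \<omega> u - S (K j u) \<omega> u)"
        by (simp add: summable_iff_convergent)
      then have "convergent (\<lambda>n. S (K n u) \<omega> u - S (K 0 u) \<omega> u)"
        by (simp add: sum_lessThan_telescope[of "\<lambda>j. S (K j u) \<omega> u"])
      then have "convergent (\<lambda>n. S (K n u) \<omega> u)"
        by (simp add: convergent_diff_const_right_iff)
      then show ?case unfolding Z_def by (simp add: convergent_LIMSEQ_iff)
    qed
    \<comment> \<open>Fatou along the subsequence turns the Cauchy bound into a bound on the distance to the limit.\<close>
    have bound: "(\<integral>\<^sup>+\<omega>. ennreal ((S n \<omega> u - Z \<omega> u)\<^sup>2) \<partial>M) \<le> ennreal (((1/2) ^ j)\<^sup>2)"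
      if n: "K j u \<le> n" for n j
    proof -
      have "(\<integral>\<^sup>+\<omega>. ennreal ((S n \<omega> u - Z \<omega> u)\<^sup>2) \<partial>M)
          = (\<integral>\<^sup>+\<omega>. liminf (\<lambda>i. ennreal ((S n \<omega> u - S (K i u) \<omega> u)\<^sup>2)) \<partial>M)"
      proof (rule nn_integral_cong_AE)
        show "AE \<omega> in M. ennreal ((S n \<omega> u - Z \<omega> u)\<^sup>2)
            = liminf (\<lambda>i. ennreal ((S n \<omega> u - S (K i u) \<omega> u)\<^sup>2))"
          using conv
        proof eventually_elim
          case (elim \<omega>)
          then have "(\<lambda>i. ennreal ((S n \<omega> u - S (K i u) \<omega> u)\<^sup>2)) \<longlonglongrightarrow> ennreal ((S n \<omega> u - Z \<omega> u)\<^sup>2)"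
            by (intro tendsto_intros) auto
          from lim_imp_Liminf[OF _ this] show ?case by simp
        qed
      qed
      also have "\<dots> \<le> liminf (\<lambda>i. \<integral>\<^sup>+\<omega>. ennreal ((S n \<omega> u - S (K i u) \<omega> u)\<^sup>2) \<partial>M)"
        by (rule nn_integral_liminf) simp
      also have "\<dots> \<le> liminf (\<lambda>i. ennreal (((1/2) ^ j)\<^sup>2))"
      proof (rule Liminf_mono, rule eventually_sequentiallyI[of j])
        fix i assume "j \<le> i"
        then have "D n (K i u) u < ((1/2) ^ j)\<^sup>2" using K[of j] K_mono n by blast
        then show "(\<integral>\<^sup>+\<omega>. ennreal ((S n \<omega> u - S (K i u) \<omega> u)\<^sup>2) \<partial>M) \<le> ennreal (((1/2) ^ j)\<^sup>2)"
          using dq[of n "K i u"]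
          by (subst nn_integral_eq_integral) (auto simp: D_def square_integrable_def intro!: ennreal_leI)
      qed
      also have "\<dots> = ennreal (((1/2) ^ j)\<^sup>2)" by (simp add: Liminf_const)
      finally show ?thesis .
    qed
    have int: "integrable M (\<lambda>\<omega>. (S (K 0 u) \<omega> u - Z \<omega> u)\<^sup>2)"
      using bound[of 0 "K 0 u"] by (intro integrableI_bounded) (auto simp: top_unique less_top[symmetric])
    then have "square_integrable M (\<lambda>\<omega>. S (K 0 u) \<omega> u - Z \<omega> u)"
      by (simp add: square_integrable_def)
    from square_integrable_diff[OF Sq this, of "K 0 u"]
    have Zq: "square_integrable M (\<lambda>\<omega>. Z \<omega> u)" by simp
    have le: "(\<integral>\<omega>. (S n \<omega> u - Z \<omega> u)\<^sup>2 \<partial>M) \<le> ((1/2) ^ j)\<^sup>2" if n: "K j u \<le> n" for n j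
    proof -
      have "integrable M (\<lambda>\<omega>. (S n \<omega> u - Z \<omega> u)\<^sup>2)"
        using square_integrable_diff[OF Sq Zq] by (simp add: square_integrable_def)
      from nn_integral_eq_integral[OF this] bound[OF n] show ?thesis by simp
    qed
    have "(\<lambda>n. \<integral>\<omega>. (S n \<omega> u - Z \<omega> u)\<^sup>2 \<partial>M) \<longlonglongrightarrow> 0"
    proof (rule LIMSEQ_I)
      fix r :: real assume "0 < r"
      then obtain j where j: "(1/4) ^ j < r" using real_arch_pow_inv[of r "1/4"] by auto
      have "norm ((\<integral>\<omega>. (S n \<omega> u - Z \<omega> u)\<^sup>2 \<partial>M) - 0) < r" if "K j u \<le> n" for n
        using le[OF that] j by (simp add: power2_eq_square power_mult_distrib[symmetric])
      then show "\<exists>no. \<forall>n\<ge>no. norm ((\<integral>\<omega>. (S n \<omega> u - Z \<omega> u)\<^sup>2 \<partial>M) - 0) < r" by blast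
    qed
    then show ?thesis using Sq Zq by (simp add: ms_limit_def square_integrable_def)
  qed
  with Zm show ?thesis by blast
qed

section \<open>Kernel operators on a window\<close>

text \<open>
  The kernel is continuous on the full square, but the operator integrates over a window \<open>S\<close> only.
  With the restricted measure \<open>N\<close>, inner products over the window become plain integrals.
\<close>

locale kernel_window =
  fixes a b :: real and \<gamma> :: "real \<Rightarrow> real \<Rightarrow> real" and S :: "real set"
  assumes kernel_continuous: "continuous_on ({a..b} \<times> {a..b}) (\<lambda>(s, t). \<gamma> s t)"
    and kernel_sym: "\<And>s t. s \<in> {a..b} \<Longrightarrow> t \<in> {a..b} \<Longrightarrow> \<gamma> s t = \<gamma> t s"
    and window_borel [measurable]: "S \<in> sets borel"
    and window_subset: "S \<subseteq> {a..b}"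
begin

abbreviation N :: "real measure" where
  "N \<equiv> restrict_space lborel S"

lemma space_N: "space N = S"
  by (simp add: space_restrict_space)

sublocale N: finite_measure N
proof
  have "emeasure lborel S \<le> emeasure lborel {a..b}"
    using window_subset by (intro emeasure_mono) auto
  also have "\<dots> < \<infinity>" by (simp add: emeasure_lborel_Icc_eq)
  finally show "emeasure N (space N) \<noteq> \<infinity>"
    by (simp add: space_N emeasure_restrict_space)
qed

lemma l2_inner_N: "l2_inner S f g = (\<integral>t. f t * g t \<partial>N)"
  by (simp add: l2_inner_def set_lebesgue_integral_def integral_restrict_space)

lemma in_l2_N: "in_l2 S f \<longleftrightarrow> square_integrable N f"
  by (simp add: in_l2_def square_integrable_def set_borel_measurable_def set_integrable_def
      integrable_restrict_space borel_measurable_restrict_space_iff mult.commute)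

lemma AE_N: "(AE t in lborel. t \<in> S \<longrightarrow> P t) \<longleftrightarrow> (AE t in N. P t)"
  by (simp add: AE_restrict_space_iff)

lemma square_integrable_continuous:
  assumes "continuous_on {a..b} f" shows "square_integrable N f"
proof -
  have "f \<in> borel_measurable (restrict_space borel S)"
    using continuous_on_subset[OF assms window_subset] by (rule borel_measurable_continuous_on_restrict)
  then have m: "f \<in> borel_measurable N"
    by (simp add: borel_measurable_restrict_space_iff)
  have "bounded (f ` {a..b})"
    using assms by (intro compact_imp_bounded compact_continuous_image) auto
  then obtain K where "\<And>t. t \<in> {a..b} \<Longrightarrow> \<bar>f t\<bar> \<le> K"
    unfolding bounded_iff by (metis imageI real_norm_def)
  with m window_subset show ?thesis
    by (intro N.square_integrable_bounded[of _ K]) (auto simp: space_N)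
qed

lemma kernel_section_continuous:
  assumes "u \<in> {a..b}" shows "continuous_on {a..b} (\<gamma> u)"
proof -
  have "continuous_on {a..b} ((\<lambda>(s, t). \<gamma> s t) \<circ> (\<lambda>t. (u, t)))"
    using assms by (intro continuous_on_compose continuous_intros
        continuous_on_subset[OF kernel_continuous]) auto
  then show ?thesis by (simp add: comp_def)
qed

lemmas kernel_section = square_integrable_continuous[OF kernel_section_continuous]

lemma kernel_bounded: "\<exists>K. \<forall>s\<in>{a..b}. \<forall>t\<in>{a..b}. \<bar>\<gamma> s t\<bar> \<le> K"
proof -
  have "bounded ((\<lambda>(s, t). \<gamma> s t) ` ({a..b} \<times> {a..b}))"
    using kernel_continuous by (intro compact_imp_bounded compact_continuous_image compact_Times) auto
  then obtain K where "\<And>p. p \<in> {a..b} \<times> {a..b} \<Longrightarrow> \<bar>case p of (s, t) \<Rightarrow> \<gamma> s t\<bar> \<le> K"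
    by (auto simp: bounded_iff)
  then show ?thesis by fastforce
qed

lemma kernel_square_integrable: "square_integrable (N \<Otimes>\<^sub>M N) (case_prod \<gamma>)"
proof -
  obtain K where K: "\<And>s t. s \<in> {a..b} \<Longrightarrow> t \<in> {a..b} \<Longrightarrow> \<bar>\<gamma> s t\<bar> \<le> K"
    using kernel_bounded by blast
  interpret NN: pair_sigma_finite N N ..
  interpret NN: finite_measure "N \<Otimes>\<^sub>M N"
    by (rule finite_measure_pair_measure) unfold_locales
  \<comment> \<open>Clipping extends the kernel continuously to the plane without changing it on the window.\<close>
  define c where "c t = max a (min b t)" for t
  have "continuous_on UNIV ((\<lambda>(s, t). \<gamma> s t) \<circ> (\<lambda>p. (c (fst p), c (snd p))))" if "a \<le> b"
    unfolding c_def using that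
    by (intro continuous_on_compose continuous_intros continuous_on_subset[OF kernel_continuous]) auto
  then have m: "(\<lambda>p. \<gamma> (c (fst p)) (c (snd p))) \<in> borel_measurable borel" if "a \<le> b"
    using that by (simp add: comp_def borel_measurable_continuous_onI)
  have "(\<lambda>p. \<gamma> (fst p) (snd p)) \<in> borel_measurable (N \<Otimes>\<^sub>M N)"
  proof (cases "a \<le> b")
    case True
    have i: "(\<lambda>t. t) \<in> measurable N borel" by (rule measurable_restrict_space1) simp
    have id: "(\<lambda>p. (fst p, snd p)) \<in> measurable (N \<Otimes>\<^sub>M N) borel"
      unfolding borel_prod[symmetric]
      by (intro measurable_Pair measurable_compose[OF measurable_fst i] measurable_compose[OF measurable_snd i])
    have "(\<lambda>p. \<gamma> (c (fst p)) (c (snd p))) \<in> borel_measurable (N \<Otimes>\<^sub>M N)"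
      using measurable_compose[OF id m[OF True]] by simp
    then show ?thesis
    proof (rule measurable_cong[THEN iffD1, rotated])
      fix p assume "p \<in> space (N \<Otimes>\<^sub>M N)"
      then have "fst p \<in> {a..b}" "snd p \<in> {a..b}"
        using window_subset by (auto simp: space_pair_measure space_N)
      then have "c (fst p) = fst p" "c (snd p) = snd p" by (auto simp: c_def)
      then show "\<gamma> (c (fst p)) (c (snd p)) = \<gamma> (fst p) (snd p)" by simp
    qed
  next
    case False
    then have "S = {}" using window_subset by auto
    then have "space (N \<Otimes>\<^sub>M N) = {}" unfolding space_pair_measure space_N by simp
    then show ?thesis unfolding measurable_def by simp
  qed
  then show ?thesis
    using K window_subset
    by (intro NN.square_integrable_bounded[of _ K])
       (auto simp: case_prod_unfold space_pair_measure space_N subset_iff)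
qed

definition nrm :: "(real \<Rightarrow> real) \<Rightarrow> real" where
  "nrm f = sqrt (\<integral>t. (f t)\<^sup>2 \<partial>N)"

text \<open>
  The image is defined at every point, also outside the window. It is therefore a continuous
  function on all of \<open>{a..b}\<close>, and up to the factor \<open>lam k\<close> the image of an eigenfunction is its
  extension \<open>phi_ext\<close>.
\<close>

definition integral_op :: "(real \<Rightarrow> real) \<Rightarrow> real \<Rightarrow> real" where
  "integral_op f u = (\<integral>t. \<gamma> u t * f t \<partial>N)"

lemma integral_op_diff_le:
  assumes "u \<in> {a..b}" "v \<in> {a..b}" "square_integrable N f"
    and "\<And>t. t \<in> {a..b} \<Longrightarrow> \<bar>\<gamma> u t - \<gamma> v t\<bar> \<le> e"
  shows "\<bar>integral_op f u - integral_op f v\<bar> \<le> e * sqrt (measure N S) * nrm f"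
proof (cases "S = {}")
  case True
  have "integral_op f w = 0" for w unfolding integral_op_def by (simp add: True integral_restrict_space)
  then show ?thesis by (simp add: True)
next
  case False
  then obtain t where t: "t \<in> {a..b}" using window_subset by (metis ex_in_conv subsetD)
  have "0 \<le> e" using assms(4)[OF t] by linarith
  have q: "square_integrable N (\<lambda>t. \<gamma> u t - \<gamma> v t)"
    by (intro square_integrable_diff kernel_section assms)
  have "integral_op f u - integral_op f v = (\<integral>t. (\<gamma> u t - \<gamma> v t) * f t \<partial>N)"
    using assms by (simp add: integral_op_def left_diff_distrib integrable_mult_square_integrable kernel_section)
  also have "\<bar>\<dots>\<bar> \<le> sqrt (\<integral>t. (\<gamma> u t - \<gamma> v t)\<^sup>2 \<partial>N) * nrm f"
    unfolding nrm_def by (rule abs_integral_mult_le[OF q assms(3)])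
  also have "(\<integral>t. (\<gamma> u t - \<gamma> v t)\<^sup>2 \<partial>N) \<le> (\<integral>t. e\<^sup>2 \<partial>N)"
  proof (rule integral_mono)
    show "integrable N (\<lambda>t. (\<gamma> u t - \<gamma> v t)\<^sup>2)" using q by (simp add: square_integrable_def)
    show "(\<gamma> u t - \<gamma> v t)\<^sup>2 \<le> e\<^sup>2" if "t \<in> space N" for t
      using assms(4)[of t] that window_subset by (auto simp: abs_le_square_iff[symmetric] space_N)
  qed simp
  then have "sqrt (\<integral>t. (\<gamma> u t - \<gamma> v t)\<^sup>2 \<partial>N) * nrm f \<le> sqrt (\<integral>t. e\<^sup>2 \<partial>N) * nrm f"
    by (intro mult_right_mono) (auto simp: nrm_def)
  also have "sqrt (\<integral>t. e\<^sup>2 \<partial>N) = e * sqrt (measure N S)"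
    using \<open>0 \<le> e\<close> by (simp add: space_N real_sqrt_mult mult.commute)
  finally show ?thesis by simp
qed

lemma integral_op_bounded: "\<exists>C\<ge>0. \<forall>u\<in>{a..b}. \<forall>f. square_integrable N f \<longrightarrow> \<bar>integral_op f u\<bar> \<le> C * nrm f"
proof -
  obtain K where K: "\<And>s t. s \<in> {a..b} \<Longrightarrow> t \<in> {a..b} \<Longrightarrow> \<bar>\<gamma> s t\<bar> \<le> K"
    using kernel_bounded by blast
  have "\<bar>integral_op f u\<bar> \<le> sqrt (K\<^sup>2 * measure N S) * nrm f" if u: "u \<in> {a..b}" and f: "square_integrable N f" for u f
  proof -
    have "\<bar>integral_op f u\<bar> \<le> sqrt (\<integral>t. (\<gamma> u t)\<^sup>2 \<partial>N) * nrm f"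
      unfolding integral_op_def nrm_def by (rule abs_integral_mult_le[OF kernel_section[OF u] f])
    also have "(\<integral>t. (\<gamma> u t)\<^sup>2 \<partial>N) \<le> (\<integral>t. K\<^sup>2 \<partial>N)"
    proof (rule integral_mono)
      show "integrable N (\<lambda>t. (\<gamma> u t)\<^sup>2)" using kernel_section[OF u] by (simp add: square_integrable_def)
      show "(\<gamma> u t)\<^sup>2 \<le> K\<^sup>2" if "t \<in> space N" for t
        using K[OF u, of t] that window_subset by (auto simp: abs_le_square_iff[symmetric] space_N)
    qed simp
    then have "sqrt (\<integral>t. (\<gamma> u t)\<^sup>2 \<partial>N) * nrm f \<le> sqrt (\<integral>t. K\<^sup>2 \<partial>N) * nrm f"
      by (intro mult_right_mono) (auto simp: nrm_def)
    finally show ?thesis by (simp add: space_N mult.commute)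
  qed
  then show ?thesis by (intro exI[of _ "sqrt (K\<^sup>2 * measure N S)"]) simp
qed

text \<open>
  The modulus of continuity is that of the kernel and does not depend on the function. This is
  what makes the operator compact.
\<close>

lemma integral_op_equicontinuous:
  assumes "0 < e"
  shows "\<exists>d>0. \<forall>u\<in>{a..b}. \<forall>v\<in>{a..b}. \<bar>u - v\<bar> < d \<longrightarrow>
      (\<forall>f. square_integrable N f \<longrightarrow> \<bar>integral_op f u - integral_op f v\<bar> \<le> e * nrm f)"
proof -
  define e' where "e' = e / (sqrt (measure N S) + 1)"
  have "0 < sqrt (measure N S) + 1" by (simp add: add_nonneg_pos)
  then have e': "0 < e'" "e' * sqrt (measure N S) \<le> e"
    using assms by (auto simp: e'_def field_simps)
  have "uniformly_continuous_on ({a..b} \<times> {a..b}) (\<lambda>(s, t). \<gamma> s t)"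
    by (intro compact_uniformly_continuous kernel_continuous compact_Times) auto
  then obtain d where d: "0 < d" and
    close: "\<And>p q. p \<in> {a..b} \<times> {a..b} \<Longrightarrow> q \<in> {a..b} \<times> {a..b} \<Longrightarrow> dist q p < d \<Longrightarrow>
      dist (case q of (s, t) \<Rightarrow> \<gamma> s t) (case p of (s, t) \<Rightarrow> \<gamma> s t) < e'"
    using e'(1) unfolding uniformly_continuous_on_def by metis
  have "\<bar>integral_op f u - integral_op f v\<bar> \<le> e * nrm f"
    if uv: "u \<in> {a..b}" "v \<in> {a..b}" "\<bar>u - v\<bar> < d" and f: "square_integrable N f" for u v f
  proof -
    have "\<bar>\<gamma> u t - \<gamma> v t\<bar> \<le> e'" if "t \<in> {a..b}" for t
      using close[of "(v, t)" "(u, t)"] uv that by (auto simp: dist_Pair_Pair dist_real_def)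
    from integral_op_diff_le[OF uv(1,2) f this]
    have "\<bar>integral_op f u - integral_op f v\<bar> \<le> e' * sqrt (measure N S) * nrm f" .
    also have "\<dots> \<le> e * nrm f" using e' by (intro mult_right_mono) (auto simp: nrm_def)
    finally show ?thesis .
  qed
  with d show ?thesis by blast
qed

lemma integral_op_continuous:
  assumes f: "square_integrable N f"
  shows "continuous_on {a..b} (integral_op f)"
proof (rule continuous_onI)
  fix u e :: real assume u: "u \<in> {a..b}" and e: "0 < e"
  have p: "0 < nrm f + 1" by (simp add: nrm_def add_nonneg_pos)
  obtain d where d: "0 < d" and close: "\<And>v. v \<in> {a..b} \<Longrightarrow> \<bar>v - u\<bar> < d \<Longrightarrow>
      \<bar>integral_op f v - integral_op f u\<bar> \<le> e / (nrm f + 1) * nrm f"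
    using integral_op_equicontinuous[of "e / (nrm f + 1)"] e p f u by (metis divide_pos_pos)
  have "e / (nrm f + 1) * nrm f \<le> e" using e p by (simp add: field_simps)
  with d close show "\<exists>d>0. \<forall>v\<in>{a..b}. dist v u < d \<longrightarrow> dist (integral_op f v) (integral_op f u) \<le> e"
    by (force simp: dist_real_def)
qed

lemmas integral_op_square_integrable = square_integrable_continuous[OF integral_op_continuous]

lemma integral_op_cong: "(\<And>t. t \<in> S \<Longrightarrow> f t = g t) \<Longrightarrow> integral_op f = integral_op g"
  unfolding integral_op_def by (intro ext Bochner_Integration.integral_cong) (auto simp: space_N)

lemma integral_op_add:
  assumes "u \<in> {a..b}" "square_integrable N f" "square_integrable N g"
  shows "integral_op (\<lambda>t. f t + g t) u = integral_op f u + integral_op g u"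
  using assms by (simp add: integral_op_def distrib_left integrable_mult_square_integrable kernel_section)

lemma integral_op_scale: "integral_op (\<lambda>t. c * f t) u = c * integral_op f u"
  by (simp add: integral_op_def mult.left_commute)

lemma integral_op_symmetric:
  assumes f: "square_integrable N f" and g: "square_integrable N g"
  shows "(\<integral>s. integral_op f s * g s \<partial>N) = (\<integral>t. f t * integral_op g t \<partial>N)"
proof -
  have "(\<integral>s. integral_op f s * g s \<partial>N) = (\<integral>t. (\<integral>s. \<gamma> s t * g s \<partial>N) * f t \<partial>N)"
    unfolding integral_op_def
    by (rule integral_integral_mult_swap[OF _ _ kernel_square_integrable f g]) unfold_locales
  also have "\<dots> = (\<integral>t. f t * integral_op g t \<partial>N)"
  proof (rule Bochner_Integration.integral_cong[OF refl])
    fix t assume t: "t \<in> space N"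
    have "(\<integral>s. \<gamma> s t * g s \<partial>N) = integral_op g t"
      unfolding integral_op_def using kernel_sym[of _ t] t window_subset
      by (intro Bochner_Integration.integral_cong) (auto simp: space_N subset_iff)
    then show "(\<integral>s. \<gamma> s t * g s \<partial>N) * f t = f t * integral_op g t" by simp
  qed
  finally show ?thesis .
qed

lemma ms_limit_integral_op_pointwise:
  assumes "ms_limit N F f" "u \<in> {a..b}"
  shows "(\<lambda>n. integral_op (F n) u) \<longlonglongrightarrow> integral_op f u"
  using ms_limit_inner[OF assms(1) kernel_section[OF assms(2)]]
  by (simp add: integral_op_def mult.commute)

lemma ms_limit_integral_op:
  assumes F: "ms_limit N F f"
  shows "ms_limit N (\<lambda>n. integral_op (F n)) (integral_op f)"
proof -
  note q = ms_limit_square_integrable[OF F]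
  obtain C where C: "0 \<le> C" "\<And>u f. u \<in> {a..b} \<Longrightarrow> square_integrable N f \<Longrightarrow> \<bar>integral_op f u\<bar> \<le> C * nrm f"
    using integral_op_bounded by blast
  show ?thesis
  proof (rule N.ms_limit_of_uniform)
    fix n x assume "x \<in> space N"
    then have x: "x \<in> {a..b}" using window_subset by (auto simp: space_N)
    have "integral_op (F n) x - integral_op f x = integral_op (\<lambda>t. F n t - f t) x"
      using q x by (simp add: integral_op_def right_diff_distrib integrable_mult_square_integrable kernel_section)
    then show "\<bar>integral_op (F n) x - integral_op f x\<bar> \<le> C * nrm (\<lambda>t. F n t - f t)"
      using C(2)[OF x square_integrable_diff[OF q]] by simp
  next
    have "(\<lambda>n. sqrt (\<integral>t. (F n t - f t)\<^sup>2 \<partial>N)) \<longlonglongrightarrow> sqrt 0"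
      using F by (intro tendsto_intros) (simp add: ms_limit_def)
    then show "(\<lambda>n. C * nrm (\<lambda>t. F n t - f t)) \<longlonglongrightarrow> 0"
      unfolding nrm_def by (intro tendsto_mult_right_zero) simp
  qed (intro integral_op_square_integrable q)+
qed

lemma eigen_eq_iff_integral_op: "eigen_eq \<gamma> S \<mu> f \<longleftrightarrow> square_integrable N f \<and> (AE u in N. integral_op f u = \<mu> * f u)"
  by (simp add: eigen_eq_def in_l2_N AE_N l2_inner_N integral_op_def)

lemma inner_integral_op_eigen:
  assumes "eigen_eq \<gamma> S \<mu> \<phi>" "square_integrable N f"
  shows "(\<integral>t. integral_op f t * \<phi> t \<partial>N) = \<mu> * (\<integral>t. f t * \<phi> t \<partial>N)"
proof -
  have \<phi>: "square_integrable N \<phi>" and e: "AE t in N. integral_op \<phi> t = \<mu> * \<phi> t"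
    using assms(1) by (auto simp: eigen_eq_iff_integral_op)
  have "(\<integral>t. integral_op f t * \<phi> t \<partial>N) = (\<integral>t. f t * integral_op \<phi> t \<partial>N)" by (rule integral_op_symmetric[OF assms(2) \<phi>])
  also have "\<dots> = (\<integral>t. \<mu> * (f t * \<phi> t) \<partial>N)"
  proof (rule integral_cong_AE)
    show "AE t in N. f t * integral_op \<phi> t = \<mu> * (f t * \<phi> t)" using e by eventually_elim simp
  qed (use assms(2) \<phi> integral_op_square_integrable[OF \<phi>] in \<open>auto simp: square_integrable_def\<close>)
  finally show ?thesis by simp
qed

text \<open>
  Power iteration. Let \<open>g n\<close> be the normalised \<open>n\<close>-th iterate of \<open>w\<close> under the operator \<open>T\<close>. By
  symmetry and Cauchy-Schwarz the numbers \<open>\<parallel>T (g n)\<parallel>\<^sup>2\<close> increase to some \<open>q > 0\<close>, and expanding the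
  square shows that \<open>T (T (g n)) - q g n\<close> tends to zero. A subsequence of \<open>T (g n)\<close> converges uniformly, so
  the same subsequence of \<open>g n\<close> converges in norm, and its limit is an eigenfunction of the squared
  operator. Orthogonality to an eigenfunction survives each application of \<open>T\<close> and the limit.
\<close>

lemma ex_eigenfunction_square:
  assumes w: "continuous_on {a..b} w" and pos: "(\<integral>t. (integral_op w t)\<^sup>2 \<partial>N) \<noteq> 0"
  shows "\<exists>q g. 0 < q \<and> continuous_on {a..b} g \<and> (\<integral>t. (g t)\<^sup>2 \<partial>N) = 1 \<and>
      (\<forall>u. integral_op (integral_op g) u = q * g u) \<and>
      (\<forall>\<mu> \<phi>. eigen_eq \<gamma> S \<mu> \<phi> \<and> (\<integral>t. w t * \<phi> t \<partial>N) = 0 \<longrightarrow> (\<integral>t. g t * \<phi> t \<partial>N) = 0)"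
proof -
  define p where "p n = (integral_op ^^ n) w" for n
  define c where "c n = (\<integral>t. (p n t)\<^sup>2 \<partial>N)" for n
  have p_Suc: "p (Suc n) = integral_op (p n)" for n by (simp add: p_def)
  have p_cont: "continuous_on {a..b} (p n)" for n
    by (induction n) (use w in \<open>simp_all add: p_Suc integral_op_continuous square_integrable_continuous, simp add: p_def\<close>)
  note p_sq [simp] = square_integrable_continuous[OF p_cont]
  have c_nonneg: "0 \<le> c n" for n by (simp add: c_def)
  have c_CS: "(c (Suc n))\<^sup>2 \<le> c n * c (Suc (Suc n))" for n
  proof -
    have "c (Suc n) = (\<integral>t. integral_op (p n) t * p (Suc n) t \<partial>N)"
      by (simp add: c_def p_Suc power2_eq_square)
    also have "\<dots> = (\<integral>t. p n t * p (Suc (Suc n)) t \<partial>N)"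
      unfolding p_Suc[of "Suc n"] by (rule integral_op_symmetric) simp_all
    finally show ?thesis
      using integral_Cauchy_Schwarz[OF p_sq[of n] p_sq[of "Suc (Suc n)"]] by (simp add: c_def)
  qed
  have c_pos_Suc: "0 < c (Suc n)" for n
  proof (induction n)
    case 0
    show ?case using pos c_nonneg[of 1] by (simp add: c_def p_Suc) (simp add: p_def less_le)
  next
    case (Suc n)
    then have "0 < c n * c (Suc (Suc n))" using c_CS[of n] by (smt (verit) zero_less_power)
    then show ?case using c_nonneg[of n] by (simp add: zero_less_mult_iff)
  qed
  have c_pos: "0 < c n" for n
  proof (cases n)
    case 0
    have "0 < c 0 * c (Suc (Suc 0))" using c_CS[of 0] c_pos_Suc[of 0] by (smt (verit) zero_less_power)
    then show ?thesis using c_pos_Suc[of "Suc 0"] 0 by (simp add: zero_less_mult_iff)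
  qed (use c_pos_Suc in simp)
  obtain C where C: "0 \<le> C" "\<And>u f. u \<in> {a..b} \<Longrightarrow> square_integrable N f \<Longrightarrow> \<bar>integral_op f u\<bar> \<le> C * nrm f"
    using integral_op_bounded by blast
  \<comment> \<open>The ratios increase because the \<open>c n\<close> are log-convex, and they are bounded because the
    operator is; so they converge.\<close>
  define r where "r n = c (Suc n) / c n" for n
  have r_pos: "0 < r n" for n using c_pos by (simp add: r_def)
  have "incseq r"
  proof (rule incseq_SucI)
    show "r n \<le> r (Suc n)" for n
      using c_CS[of n] c_pos[of n] c_pos[of "Suc n"]
      by (simp add: r_def field_simps power2_eq_square)
  qed
  moreover have "r n \<le> C\<^sup>2 * measure N S" for n
  proof -
    have "c (Suc n) \<le> (\<integral>t. (C\<^sup>2 * c n) \<partial>N)"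
      unfolding c_def[of "Suc n"]
    proof (rule integral_mono)
      show "integrable N (\<lambda>t. (p (Suc n) t)\<^sup>2)" using p_sq by (simp add: square_integrable_def del: p_sq)
      fix t assume "t \<in> space N"
      then have "\<bar>p (Suc n) t\<bar> \<le> C * nrm (p n)"
        using C(2)[of t "p n"] window_subset by (auto simp: p_Suc space_N)
      then have "(p (Suc n) t)\<^sup>2 \<le> (C * nrm (p n))\<^sup>2"
        using abs_le_square_iff[of "p (Suc n) t" "C * nrm (p n)"] by simp
      also have "\<dots> = C\<^sup>2 * c n" by (simp add: nrm_def c_def power_mult_distrib)
      finally show "(p (Suc n) t)\<^sup>2 \<le> C\<^sup>2 * c n" .
    qed simp
    then show ?thesis using c_pos[of n] by (simp add: r_def space_N field_simps)
  qed
  ultimately obtain q where r_lim: "r \<longlonglongrightarrow> q" and r_le: "\<And>n. r n \<le> q"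
    using incseq_convergent[of r "C\<^sup>2 * measure N S"] by blast
  have q: "0 < q" using r_pos[of 0] r_le[of 0] by linarith
  define g where "g n t = 1 / sqrt (c n) * p n t" for n t
  have g_cont: "continuous_on {a..b} (g n)" for n
    unfolding g_def by (intro continuous_intros p_cont)
  note g_sq [simp] = square_integrable_continuous[OF g_cont]
  have Tg: "integral_op (g n) = (\<lambda>t. 1 / sqrt (c n) * p (Suc n) t)" for n
    unfolding g_def p_Suc by (intro ext integral_op_scale)
  have TTg: "integral_op (integral_op (g n)) = (\<lambda>t. 1 / sqrt (c n) * p (Suc (Suc n)) t)" for n
    unfolding Tg p_Suc[of "Suc n"] by (intro ext integral_op_scale)
  have nrm_g: "nrm (g n) = 1" for n
    using c_pos[of n] by (simp add: nrm_def g_def power_mult_distrib power_divide c_def[symmetric] less_imp_le)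
  \<comment> \<open>Compactness: the images of the unit vectors are bounded and equicontinuous.\<close>
  obtain h k where h: "continuous_on {a..b} h" and k: "strict_mono (k :: nat \<Rightarrow> nat)"
    and unif: "\<And>e. 0 < e \<Longrightarrow> \<exists>N. \<forall>n x. n \<ge> N \<and> x \<in> {a..b} \<longrightarrow> norm (integral_op (g (k n)) x - h x) < e"
  proof (rule Arzela_Ascoli[of "{a..b}" "\<lambda>n. integral_op (g n)" C])
    show "norm (integral_op (g n) x) \<le> C" if "x \<in> {a..b}" for n x
      using C(2)[OF that, of "g n"] by (simp add: nrm_g)
    show "\<exists>d>0. \<forall>n y. y \<in> {a..b} \<and> norm (x - y) < d \<longrightarrow> norm (integral_op (g n) x - integral_op (g n) y) < e"
      if x: "x \<in> {a..b}" and e: "0 < e" for x e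
    proof -
      obtain d where d: "0 < d" and close: "\<And>v f. v \<in> {a..b} \<Longrightarrow> \<bar>x - v\<bar> < d \<Longrightarrow>
          square_integrable N f \<Longrightarrow> \<bar>integral_op f x - integral_op f v\<bar> \<le> e / 2 * nrm f"
        using integral_op_equicontinuous[of "e / 2"] e x by (metis half_gt_zero)
      have "norm (integral_op (g n) x - integral_op (g n) y) < e" if "y \<in> {a..b}" "norm (x - y) < d" for n y
        using close[OF that(1) _ g_sq, of n] that(2) e by (simp add: nrm_g)
      with d show ?thesis by blast
    qed
  qed (use that in auto)
  have Tg_lim: "ms_limit N (\<lambda>n. integral_op (g (k n))) h"
  proof -
    have "\<exists>e. (\<forall>n. \<forall>x\<in>{a..b}. \<bar>integral_op (g (k n)) x - h x\<bar> \<le> e n) \<and> e \<longlonglongrightarrow> 0"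
    proof (intro exI conjI allI ballI)
      define e where "e n = (SUP x\<in>{a..b}. \<bar>integral_op (g (k n)) x - h x\<bar>)" for n
      have cont: "continuous_on {a..b} (\<lambda>x. \<bar>integral_op (g (k n)) x - h x\<bar>)" for n
        by (intro continuous_intros h integral_op_continuous g_sq)
      show "\<bar>integral_op (g (k n)) x - h x\<bar> \<le> e n" if "x \<in> {a..b}" for n x
        unfolding e_def using that cont[of n]
        by (intro cSUP_upper bounded_imp_bdd_above compact_imp_bounded compact_continuous_image) auto
      show "e \<longlonglongrightarrow> 0"
      proof (rule LIMSEQ_I)
        fix \<epsilon> :: real assume \<epsilon>: "0 < \<epsilon>"
        obtain n0 where n0: "\<And>n x. n \<ge> n0 \<Longrightarrow> x \<in> {a..b} \<Longrightarrow> \<bar>integral_op (g (k n)) x - h x\<bar> < \<epsilon> / 2"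
          using unif[of "\<epsilon> / 2"] \<epsilon> by (auto simp: real_norm_def)
        have ne: "{a..b} \<noteq> {}"
        proof
          assume "{a..b} = {}"
          then have "S = {}" using window_subset by auto
          then have "c 0 = 0" unfolding c_def by (simp add: integral_restrict_space)
          with c_pos[of 0] show False by simp
        qed
        have "norm (e n - 0) < \<epsilon>" if n: "n0 \<le> n" for n
        proof -
          obtain x0 where x0: "x0 \<in> {a..b}" using ne by blast
          have "0 \<le> \<bar>integral_op (g (k n)) x0 - h x0\<bar>" by simp
          also have "\<dots> \<le> e n"
            unfolding e_def using x0 cont[of n]
            by (intro cSUP_upper bounded_imp_bdd_above compact_imp_bounded compact_continuous_image) auto
          finally have "0 \<le> e n" .
          moreover have "e n \<le> \<epsilon> / 2"
            unfolding e_def using n0[OF n] ne by (intro cSUP_least) (auto intro: less_imp_le)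
          ultimately show ?thesis using \<epsilon> by simp
        qed
        then show "\<exists>no. \<forall>n\<ge>no. norm (e n - 0) < \<epsilon>" by blast
      qed
    qed
    then obtain e where e: "\<And>n x. x \<in> {a..b} \<Longrightarrow> \<bar>integral_op (g (k n)) x - h x\<bar> \<le> e n" "e \<longlonglongrightarrow> 0" by blast
    show ?thesis
      by (rule N.ms_limit_of_uniform[OF integral_op_square_integrable[OF g_sq] square_integrable_continuous[OF h] _ e(2)])
         (use window_subset in \<open>auto simp: space_N intro!: e(1)\<close>)
  qed
  \<comment> \<open>The iterates become approximate eigenvectors of the squared operator.\<close>
  have defect: "(\<integral>t. (integral_op (integral_op (g n)) t - q * g n t)\<^sup>2 \<partial>N) = r (Suc n) * r n - 2 * q * r n + q\<^sup>2" for n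
  proof -
    have 1: "(\<integral>t. (integral_op (integral_op (g n)) t)\<^sup>2 \<partial>N) = r (Suc n) * r n"
      using c_pos[of n] c_pos[of "Suc n"]
      by (simp add: TTg power_mult_distrib power_divide c_def[symmetric] r_def less_imp_le)
    have "(\<integral>t. integral_op (integral_op (g n)) t * g n t \<partial>N) = (\<integral>t. integral_op (g n) t * integral_op (g n) t \<partial>N)"
      by (rule integral_op_symmetric[OF integral_op_square_integrable[OF g_sq] g_sq])
    also have "\<dots> = (\<integral>t. (integral_op (g n) t)\<^sup>2 \<partial>N)" by (simp add: power2_eq_square)
    also have "\<dots> = r n"
      using c_pos[of n] by (simp add: Tg power_mult_distrib power_divide c_def[symmetric] r_def less_imp_le)
    finally have 2: "(\<integral>t. integral_op (integral_op (g n)) t * g n t \<partial>N) = r n" .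
    have 3: "(\<integral>t. (g n t)\<^sup>2 \<partial>N) = 1"
      using nrm_g[of n] by (simp add: nrm_def)
    show ?thesis
      unfolding integral_square_diff[OF integral_op_square_integrable[OF integral_op_square_integrable[OF g_sq]]
          square_integrable_scale[OF g_sq]] 1
      by (simp add: mult.left_commute[of _ q] 2 power_mult_distrib 3)
  qed
  have "ms_limit N (\<lambda>n t. integral_op (integral_op (g (k n))) t - q * g (k n) t) (\<lambda>_. 0)"
  proof -
    have "(\<lambda>n. r (Suc n) * r n - 2 * q * r n + q\<^sup>2) \<longlonglongrightarrow> q * q - 2 * q * q + q\<^sup>2"
      by (intro tendsto_intros r_lim LIMSEQ_Suc)
    then have "(\<lambda>n. \<integral>t. (integral_op (integral_op (g n)) t - q * g n t)\<^sup>2 \<partial>N) \<longlonglongrightarrow> 0"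
      unfolding defect by (simp add: power2_eq_square)
    from LIMSEQ_subseq_LIMSEQ[OF this k]
    have "(\<lambda>n. \<integral>t. (integral_op (integral_op (g (k n))) t - q * g (k n) t)\<^sup>2 \<partial>N) \<longlonglongrightarrow> 0" by (simp add: comp_def)
    moreover have "square_integrable N (\<lambda>t. integral_op (integral_op (g (k n))) t - q * g (k n) t)" for n
      by (intro square_integrable_diff square_integrable_scale integral_op_square_integrable g_sq)
    ultimately show ?thesis by (simp add: ms_limit_def square_integrable_def)
  qed
  from ms_limit_scale[OF ms_limit_diff[OF ms_limit_integral_op[OF Tg_lim] this], of "1 / q"]
  have g_lim: "ms_limit N (\<lambda>n. g (k n)) (\<lambda>t. 1 / q * integral_op h t)"
    using q by simp
  define f where "f t = 1 / q * integral_op h t" for t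
  have f_lim: "ms_limit N (\<lambda>n. g (k n)) f" using g_lim by (simp add: f_def[abs_def])
  have f_cont: "continuous_on {a..b} f"
    unfolding f_def by (intro continuous_intros integral_op_continuous square_integrable_continuous h)
  have h_eq: "h u = integral_op f u" if u: "u \<in> {a..b}" for u
  proof (rule LIMSEQ_unique)
    show "(\<lambda>n. integral_op (g (k n)) u) \<longlonglongrightarrow> integral_op f u" by (rule ms_limit_integral_op_pointwise[OF f_lim u])
    show "(\<lambda>n. integral_op (g (k n)) u) \<longlonglongrightarrow> h u"
      using unif u by (intro LIMSEQ_I) blast
  qed
  have "integral_op h = integral_op (integral_op f)" using h_eq window_subset by (intro integral_op_cong) auto
  then have TTf: "integral_op (integral_op f) u = q * f u" for u using q by (simp add: f_def)
  have f_norm: "(\<integral>t. (f t)\<^sup>2 \<partial>N) = 1"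
  proof (rule LIMSEQ_unique)
    have z: "square_integrable N (\<lambda>_. 0)" by (simp add: square_integrable_def)
    show "(\<lambda>n. \<integral>t. (g (k n) t)\<^sup>2 \<partial>N) \<longlonglongrightarrow> (\<integral>t. (f t)\<^sup>2 \<partial>N)"
      using ms_limit_distance[OF f_lim z] by simp
    have "(\<integral>t. (g n t)\<^sup>2 \<partial>N) = 1" for n using nrm_g[of n] by (simp add: nrm_def)
    then show "(\<lambda>n. \<integral>t. (g (k n) t)\<^sup>2 \<partial>N) \<longlonglongrightarrow> 1" by simp
  qed
  have orth: "(\<integral>t. f t * \<phi> t \<partial>N) = 0"
    if \<phi>: "eigen_eq \<gamma> S \<mu> \<phi>" and w0: "(\<integral>t. w t * \<phi> t \<partial>N) = 0" for \<mu> \<phi>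
  proof -
    have "(\<integral>t. p n t * \<phi> t \<partial>N) = 0" for n
      by (induction n) (use inner_integral_op_eigen[OF \<phi> p_sq] w0 in \<open>simp_all add: p_Suc, simp add: p_def\<close>)
    then have "(\<integral>t. g n t * \<phi> t \<partial>N) = 0" for n by (simp add: g_def mult.assoc)
    moreover have "square_integrable N \<phi>" using \<phi> by (simp add: eigen_eq_iff_integral_op)
    ultimately show ?thesis using ms_limit_inner[OF f_lim, of \<phi>] by (simp add: LIMSEQ_const_iff)
  qed
  show ?thesis using q f_cont f_norm TTf orth by blast
qed

text \<open>
  Otherwise power iteration started at \<open>w\<close> would yield an eigenfunction for a nonzero eigenvalue that
  is orthogonal to all \<open>\<phi> k\<close>, although every such eigenfunction is a multiple of some \<open>\<phi> k\<close>.
\<close>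

lemma integral_op_zero_of_orthogonal_eigensystem:
  assumes es: "eigensystem \<gamma> S \<phi> lam" and w: "continuous_on {a..b} w"
    and orth: "\<And>k. (\<integral>t. w t * \<phi> k t \<partial>N) = 0"
  shows "(\<integral>t. (integral_op w t)\<^sup>2 \<partial>N) = 0"
proof (rule ccontr)
  assume "(\<integral>t. (integral_op w t)\<^sup>2 \<partial>N) \<noteq> 0"
  from ex_eigenfunction_square[OF w this] obtain q g where q: "0 < q"
    and g: "continuous_on {a..b} g" and norm: "(\<integral>t. (g t)\<^sup>2 \<partial>N) = 1"
    and TTg: "\<And>u. integral_op (integral_op g) u = q * g u"
    and g_orth': "\<And>\<mu> \<phi>. eigen_eq \<gamma> S \<mu> \<phi> \<Longrightarrow> (\<integral>t. w t * \<phi> t \<partial>N) = 0 \<Longrightarrow> (\<integral>t. g t * \<phi> t \<partial>N) = 0"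
    by blast
  have eig: "eigen_eq \<gamma> S (lam k) (\<phi> k)" for k using es by (simp add: eigensystem_def)
  have \<phi>: "square_integrable N (\<phi> k)" for k using eig[of k] by (simp add: eigen_eq_iff_integral_op)
  have g_orth: "(\<integral>t. g t * \<phi> k t \<partial>N) = 0" for k using g_orth'[OF eig orth] .
  note g_sq = square_integrable_continuous[OF g]
  have null: "AE t in N. f t = 0"
    if e: "eigen_eq \<gamma> S \<mu> f" and "\<mu> \<noteq> 0" and f: "\<And>k. (\<integral>t. f t * \<phi> k t \<partial>N) = 0" for \<mu> f
  proof (rule ccontr)
    assume "\<not> (AE t in N. f t = 0)"
    with es e \<open>\<mu> \<noteq> 0\<close> obtain k c where c: "AE t in N. f t = c * \<phi> k t"
      unfolding eigensystem_def AE_N by metis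
    have "(\<integral>t. f t * \<phi> k t \<partial>N) = (\<integral>t. c * (\<phi> k t * \<phi> k t) \<partial>N)"
    proof (rule integral_cong_AE)
      show "AE t in N. f t * \<phi> k t = c * (\<phi> k t * \<phi> k t)" using c by eventually_elim simp
    qed (use \<phi>[of k] e in \<open>auto simp: square_integrable_def eigen_eq_iff_integral_op\<close>)
    also have "\<dots> = c" using es by (simp add: eigensystem_def l2_inner_N)
    finally have "c = 0" using f by simp
    with c \<open>\<not> (AE t in N. f t = 0)\<close> show False by simp
  qed
  define \<mu> where "\<mu> = sqrt q"
  have \<mu>: "0 < \<mu>" "\<mu> * \<mu> = q" using q by (simp_all add: \<mu>_def)
  define f where "f t = integral_op g t + \<mu> * g t" for t
  \<comment> \<open>Factor \<open>G\<^sup>2 - q = (G - \<mu>) (G + \<mu>)\<close>, with \<open>G\<close> for the operator: either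
    \<open>(G + \<mu>) g\<close> is an eigenfunction for \<open>\<mu>\<close>, or \<open>g\<close> is one for \<open>-\<mu>\<close>.\<close>
  have f_sq: "square_integrable N f"
    unfolding f_def by (intro square_integrable_add square_integrable_scale g_sq integral_op_square_integrable)
  have "integral_op f u = \<mu> * f u" if "u \<in> {a..b}" for u
    unfolding f_def using integral_op_add[OF that integral_op_square_integrable[OF g_sq] square_integrable_scale[OF g_sq]]
    by (simp add: integral_op_scale TTg \<mu>(2)[symmetric] algebra_simps)
  then have "eigen_eq \<gamma> S \<mu> f"
    using f_sq window_subset by (auto simp: eigen_eq_iff_integral_op space_N intro!: AE_I2)
  moreover have "(\<integral>t. f t * \<phi> k t \<partial>N) = 0" for k
  proof -
    have "(\<integral>t. f t * \<phi> k t \<partial>N) = (\<integral>t. integral_op g t * \<phi> k t \<partial>N) + \<mu> * (\<integral>t. g t * \<phi> k t \<partial>N)"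
      using integrable_mult_square_integrable[OF integral_op_square_integrable[OF g_sq] \<phi>[of k]]
        integrable_mult_square_integrable[OF g_sq \<phi>[of k]]
      by (simp add: f_def distrib_right mult.assoc)
    then show ?thesis using inner_integral_op_eigen[OF eig g_sq, of k] g_orth by simp
  qed
  ultimately have "AE t in N. f t = 0" using \<mu>(1) by (intro null[of \<mu>]) auto
  then have "AE t in N. integral_op g t = - \<mu> * g t"
    by eventually_elim (simp add: f_def)
  then have "eigen_eq \<gamma> S (- \<mu>) g" using g_sq by (simp add: eigen_eq_iff_integral_op)
  then have "AE t in N. g t = 0" using \<mu>(1) g_orth by (intro null[of "- \<mu>"]) auto
  then have "AE t in N. (g t)\<^sup>2 = 0" by eventually_elim simp
  then have "(\<integral>t. (g t)\<^sup>2 \<partial>N) = (\<integral>t. 0 \<partial>N)"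
    using g_sq by (intro integral_cong_AE) (auto simp: square_integrable_def)
  with norm show False by simp
qed

end

section \<open>Orthogonal projections in mean square\<close>

text \<open>
  \<open>Y'\<close> is the orthogonal projection of \<open>Y\<close> onto the closed span of the \<open>\<xi> k\<close>. Membership in the
  closed span is expressed as membership in the double orthogonal complement, which turns the
  properties below into linear algebra with no approximation by finite combinations.
\<close>

definition orth_projection :: "'w measure \<Rightarrow> (nat \<Rightarrow> 'w \<Rightarrow> real) \<Rightarrow> ('w \<Rightarrow> real) \<Rightarrow> ('w \<Rightarrow> real) \<Rightarrow> bool" where
  "orth_projection M \<xi> Y Y' \<longleftrightarrow>
     square_integrable M Y \<and> square_integrable M Y' \<and>
     (\<forall>k. (\<integral>\<omega>. Y' \<omega> * \<xi> k \<omega> \<partial>M) = (\<integral>\<omega>. Y \<omega> * \<xi> k \<omega> \<partial>M)) \<and>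
     (\<forall>W. square_integrable M W \<and> (\<forall>k. (\<integral>\<omega>. W \<omega> * \<xi> k \<omega> \<partial>M) = 0) \<longrightarrow> (\<integral>\<omega>. Y' \<omega> * W \<omega> \<partial>M) = 0)"

lemma orth_projection_scale:
  assumes "orth_projection M \<xi> Y Y'"
  shows "orth_projection M \<xi> (\<lambda>\<omega>. c * Y \<omega>) (\<lambda>\<omega>. c * Y' \<omega>)"
  using assms by (auto simp: orth_projection_def square_integrable_scale mult.assoc)

lemma orth_projection_add:
  assumes \<xi>: "\<And>k. square_integrable M (\<xi> k)"
    and Y: "orth_projection M \<xi> Y Y'" and Z: "orth_projection M \<xi> Z Z'"
  shows "orth_projection M \<xi> (\<lambda>\<omega>. Y \<omega> + Z \<omega>) (\<lambda>\<omega>. Y' \<omega> + Z' \<omega>)"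
  using assms
  by (auto simp: orth_projection_def square_integrable_add distrib_right integrable_mult_square_integrable)

lemma orth_projection_diff:
  assumes "\<And>k. square_integrable M (\<xi> k)" "orth_projection M \<xi> Y Y'" "orth_projection M \<xi> Z Z'"
  shows "orth_projection M \<xi> (\<lambda>\<omega>. Y \<omega> - Z \<omega>) (\<lambda>\<omega>. Y' \<omega> - Z' \<omega>)"
  using orth_projection_add[OF assms(1,2) orth_projection_scale[OF assms(3), of "-1"]] by simp

lemma orth_projection_sum:
  assumes \<xi>: "\<And>k. square_integrable M (\<xi> k)"
    and "\<And>i. i \<in> I \<Longrightarrow> orth_projection M \<xi> (Y i) (Y' i)"
  shows "orth_projection M \<xi> (\<lambda>\<omega>. \<Sum>i\<in>I. Y i \<omega>) (\<lambda>\<omega>. \<Sum>i\<in>I. Y' i \<omega>)"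
  using assms(2)
proof (induction I rule: infinite_finite_induct)
  case (insert i I)
  then show ?case by (simp add: orth_projection_add[OF \<xi>])
qed (simp_all add: orth_projection_def square_integrable_def)

lemma orth_projection_residual:
  assumes \<xi>: "\<And>k. square_integrable M (\<xi> k)"
    and Y: "orth_projection M \<xi> Y Y'" and Z: "orth_projection M \<xi> Z Z'"
  shows "(\<integral>\<omega>. (Y \<omega> - Y' \<omega>) * Z' \<omega> \<partial>M) = 0"
proof -
  have "square_integrable M (\<lambda>\<omega>. Y \<omega> - Y' \<omega>)"
    using Y by (intro square_integrable_diff) (auto simp: orth_projection_def)
  moreover have "(\<integral>\<omega>. (Y \<omega> - Y' \<omega>) * \<xi> k \<omega> \<partial>M) = 0" for k
    using Y \<xi>[of k] by (simp add: orth_projection_def left_diff_distrib integrable_mult_square_integrable)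
  ultimately have "(\<integral>\<omega>. Z' \<omega> * (Y \<omega> - Y' \<omega>) \<partial>M) = 0"
    using Z unfolding orth_projection_def by blast
  then show ?thesis by (simp add: mult.commute)
qed

lemma orth_projection_pythagoras:
  assumes \<xi>: "\<And>k. square_integrable M (\<xi> k)"
    and Y: "orth_projection M \<xi> Y Y'" and Z: "orth_projection M \<xi> Z Z'"
  shows "(\<integral>\<omega>. (Y \<omega> - Z' \<omega>)\<^sup>2 \<partial>M) = (\<integral>\<omega>. (Y \<omega> - Y' \<omega>)\<^sup>2 \<partial>M) + (\<integral>\<omega>. (Y' \<omega> - Z' \<omega>)\<^sup>2 \<partial>M)"
proof -
  have s: "square_integrable M (\<lambda>\<omega>. Y \<omega> - Y' \<omega>)" "square_integrable M (\<lambda>\<omega>. Y' \<omega> - Z' \<omega>)"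
    using Y Z by (auto simp: orth_projection_def intro: square_integrable_diff)
  have "(\<integral>\<omega>. (Y \<omega> - Y' \<omega>) * (Y' \<omega> - Z' \<omega>) \<partial>M) = 0"
    by (rule orth_projection_residual[OF \<xi> Y orth_projection_diff[OF \<xi> Y Z]])
  then show ?thesis using integral_square_add[OF s] by simp
qed

lemma orth_projection_contraction:
  assumes \<xi>: "\<And>k. square_integrable M (\<xi> k)" and Y: "orth_projection M \<xi> Y Y'"
  shows "(\<integral>\<omega>. (Y' \<omega>)\<^sup>2 \<partial>M) \<le> (\<integral>\<omega>. (Y \<omega>)\<^sup>2 \<partial>M)"
proof -
  have "orth_projection M \<xi> (\<lambda>_. 0) (\<lambda>_. 0)" by (simp add: orth_projection_def square_integrable_def)
  from orth_projection_pythagoras[OF \<xi> Y this] show ?thesis by simp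
qed

text \<open>
  The error after projecting \<open>Z\<close> splits into the part of \<open>Y\<close> outside the span, which is the error of
  the best approximation, and the projection of \<open>Y - Z\<close>, which is no larger than \<open>Y - Z\<close>.
\<close>

lemma orth_projection_error_le:
  assumes \<xi>: "\<And>k. square_integrable M (\<xi> k)"
    and Y: "orth_projection M \<xi> Y Y'" and Z: "orth_projection M \<xi> Z Z'"
  shows "(\<integral>\<omega>. (Y \<omega> - Z' \<omega>)\<^sup>2 \<partial>M) \<le> (\<integral>\<omega>. (Y \<omega> - Y' \<omega>)\<^sup>2 \<partial>M) + (\<integral>\<omega>. (Y \<omega> - Z \<omega>)\<^sup>2 \<partial>M)"
  using orth_projection_contraction[OF \<xi> orth_projection_diff[OF \<xi> Y Z]]
  by (simp add: orth_projection_pythagoras[OF \<xi> Y Z])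

text \<open>
  Projection commutes with integration in the parameter. In the last hypothesis the exceptional null
  set may depend on \<open>W\<close>, so \<open>y\<close> need not be the pointwise projection of \<open>x\<close> outside one
  common null set.
\<close>

lemma orth_projection_integral_mult:
  assumes "sigma_finite_measure M" "sigma_finite_measure N"
    and x: "square_integrable (M \<Otimes>\<^sub>M N) (case_prod x)"
    and y: "square_integrable (M \<Otimes>\<^sub>M N) (case_prod y)"
    and \<phi>: "square_integrable N \<phi>" and \<xi>: "\<And>k. square_integrable M (\<xi> k)"
    and eq: "\<And>k t. t \<in> space N \<Longrightarrow> (\<integral>\<omega>. y \<omega> t * \<xi> k \<omega> \<partial>M) = (\<integral>\<omega>. x \<omega> t * \<xi> k \<omega> \<partial>M)"
    and null: "\<And>W. square_integrable M W \<Longrightarrow> (\<And>k. (\<integral>\<omega>. W \<omega> * \<xi> k \<omega> \<partial>M) = 0) \<Longrightarrow>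
      AE t in N. (\<integral>\<omega>. y \<omega> t * W \<omega> \<partial>M) = 0"
  shows "orth_projection M \<xi> (\<lambda>\<omega>. \<integral>t. x \<omega> t * \<phi> t \<partial>N) (\<lambda>\<omega>. \<integral>t. y \<omega> t * \<phi> t \<partial>N)"
  unfolding orth_projection_def
proof (intro conjI allI impI)
  show "square_integrable M (\<lambda>\<omega>. \<integral>t. x \<omega> t * \<phi> t \<partial>N)" "square_integrable M (\<lambda>\<omega>. \<integral>t. y \<omega> t * \<phi> t \<partial>N)"
    using assms by (auto intro: square_integrable_integral_mult)
  show "(\<integral>\<omega>. (\<integral>t. y \<omega> t * \<phi> t \<partial>N) * \<xi> k \<omega> \<partial>M) = (\<integral>\<omega>. (\<integral>t. x \<omega> t * \<phi> t \<partial>N) * \<xi> k \<omega> \<partial>M)" for k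
    unfolding integral_integral_mult_swap[OF assms(1,2) x \<phi> \<xi>] integral_integral_mult_swap[OF assms(1,2) y \<phi> \<xi>]
    by (intro Bochner_Integration.integral_cong) (simp_all add: eq)
  fix W assume W: "square_integrable M W \<and> (\<forall>k. (\<integral>\<omega>. W \<omega> * \<xi> k \<omega> \<partial>M) = 0)"
  then have "AE t in N. (\<integral>\<omega>. y \<omega> t * W \<omega> \<partial>M) = 0" by (intro null) auto
  then have "AE t in N. (\<integral>\<omega>. y \<omega> t * W \<omega> \<partial>M) * \<phi> t = 0" by eventually_elim simp
  then have "(\<integral>t. (\<integral>\<omega>. y \<omega> t * W \<omega> \<partial>M) * \<phi> t \<partial>N) = 0"
    by (rule integral_eq_zero_AE)
  then show "(\<integral>\<omega>. (\<integral>t. y \<omega> t * \<phi> t \<partial>N) * W \<omega> \<partial>M) = 0"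
    using integral_integral_mult_swap[OF assms(1,2) y \<phi>, of W] W by simp
qed

section \<open>The scores of a random function on a window\<close>

text \<open>
  Being a Hilbert choice, \<open>recon\<close> has its defining property only once a jointly measurable
  mean-square limit is known to exist.
\<close>

lemma (in prob_space) recon_is_ms_limit:
  assumes \<eta>: "\<And>k. square_integrable M (\<lambda>\<omega>. l2_inner S (x \<omega>) (\<phi> k))"
    and cont: "\<And>k. continuous_on {a..b} (phi_ext \<gamma> S \<phi> lam k)"
    and Cauchy: "\<And>u e. u \<in> {a..b} \<Longrightarrow> 0 < e \<Longrightarrow> \<exists>N. \<forall>m\<ge>N. \<forall>n\<ge>N.
      (\<integral>\<omega>. (recon_sum \<gamma> S \<phi> lam x m \<omega> u - recon_sum \<gamma> S \<phi> lam x n \<omega> u)\<^sup>2 \<partial>M) < e"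
  shows "case_prod (recon M a b \<gamma> S \<phi> lam x) \<in> borel_measurable (M \<Otimes>\<^sub>M lborel)"
    and "u \<in> {a..b} \<Longrightarrow> ms_limit M (\<lambda>n \<omega>. recon_sum \<gamma> S \<phi> lam x n \<omega> u)
      (\<lambda>\<omega>. recon M a b \<gamma> S \<phi> lam x \<omega> u)"
proof -
  define h where "h k u = indicator {a..b} u * phi_ext \<gamma> S \<phi> lam k u" for k u
  define R where "R n \<omega> u = (\<Sum>k<n. l2_inner S (x \<omega>) (\<phi> k) * h k u)" for n \<omega> u
  have R_eq: "R n \<omega> u = recon_sum \<gamma> S \<phi> lam x n \<omega> u" if "u \<in> {a..b}" for n \<omega> u
    using that by (simp add: R_def h_def recon_sum_def)
  have [measurable]: "(\<lambda>\<omega>. l2_inner S (x \<omega>) (\<phi> k)) \<in> borel_measurable M" for k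
    using \<eta> by (simp add: square_integrable_def)
  have [measurable]: "h k \<in> borel_measurable lborel" for k
    unfolding h_def using borel_measurable_continuous_on_indicator[OF _ cont[of k]] by simp
  have "\<exists>Z. case_prod Z \<in> borel_measurable (M \<Otimes>\<^sub>M lborel) \<and>
      (\<forall>u\<in>{a..b}. ms_limit M (\<lambda>n \<omega>. R n \<omega> u) (\<lambda>\<omega>. Z \<omega> u))"
  proof (rule ex_jointly_measurable_ms_limit)
    show "case_prod (R n) \<in> borel_measurable (M \<Otimes>\<^sub>M lborel)" for n
      unfolding R_def case_prod_unfold
      by (intro borel_measurable_sum borel_measurable_times measurable_compose[OF measurable_fst]
          measurable_compose[OF measurable_snd]) measurable
    show "integrable M (\<lambda>\<omega>. (R n \<omega> u)\<^sup>2)" for n u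
    proof -
      have "square_integrable M (\<lambda>\<omega>. R n \<omega> u)"
        unfolding R_def using square_integrable_scale[OF \<eta>]
        by (intro square_integrable_sum) (simp add: mult.commute)
      then show ?thesis by (simp add: square_integrable_def)
    qed
  qed (use Cauchy in \<open>simp add: R_eq\<close>)
  moreover have "(\<lambda>n \<omega>. R n \<omega> u) = (\<lambda>n \<omega>. recon_sum \<gamma> S \<phi> lam x n \<omega> u)" if "u \<in> {a..b}" for u
    using R_eq[OF that] by (intro ext)
  ultimately have ex: "\<exists>Z. case_prod Z \<in> borel_measurable (M \<Otimes>\<^sub>M lborel) \<and>
      (\<forall>u\<in>{a..b}. ms_limit M (\<lambda>n \<omega>. recon_sum \<gamma> S \<phi> lam x n \<omega> u) (\<lambda>\<omega>. Z \<omega> u))"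
    by simp
  note spec = someI_ex[OF ex, folded recon_def]
  show "case_prod (recon M a b \<gamma> S \<phi> lam x) \<in> borel_measurable (M \<Otimes>\<^sub>M lborel)" using spec by blast
  show "u \<in> {a..b} \<Longrightarrow> ms_limit M (\<lambda>n \<omega>. recon_sum \<gamma> S \<phi> lam x n \<omega> u)
      (\<lambda>\<omega>. recon M a b \<gamma> S \<phi> lam x \<omega> u)" using spec by blast
qed

locale observed_window = prob_space M for M :: "'w measure" +
  fixes X :: "'w \<Rightarrow> real \<Rightarrow> real" and a b :: real and S :: "real set"
    and \<phi> :: "nat \<Rightarrow> real \<Rightarrow> real" and lam :: "nat \<Rightarrow> real"
  assumes ab: "a \<le> b"
    and X_measurable: "\<And>t. t \<in> {a..b} \<Longrightarrow> (\<lambda>\<omega>. X \<omega> t) \<in> borel_measurable M"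
    and X_continuous: "\<And>\<omega>. \<omega> \<in> space M \<Longrightarrow> continuous_on {a..b} (X \<omega>)"
    and X_integrable: "\<And>t. t \<in> {a..b} \<Longrightarrow> integrable M (\<lambda>\<omega>. (X \<omega> t)\<^sup>2)"
    and cov_continuous: "continuous_on ({a..b} \<times> {a..b}) (\<lambda>(s, t). cov_fun M X s t)"
    and S_borel: "S \<in> sets borel" and S_subset: "S \<subseteq> {a..b}"
    and es: "eigensystem (cov_fun M X) S \<phi> lam"
begin

sublocale K: kernel_window a b "cov_fun M X" S
  using cov_continuous S_borel S_subset by unfold_locales (auto simp: cov_fun_def mult.commute)

abbreviation \<gamma> :: "real \<Rightarrow> real \<Rightarrow> real" where
  "\<gamma> \<equiv> cov_fun M X"

definition \<xi> :: "nat \<Rightarrow> 'w \<Rightarrow> real" where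
  "\<xi> k \<omega> = l2_inner S (X \<omega>) (\<phi> k)"

lemma \<xi>_eq: "\<xi> k \<omega> = (\<integral>t. X \<omega> t * \<phi> k t \<partial>K.N)"
  by (simp add: \<xi>_def K.l2_inner_N)

lemma X_sq: "t \<in> {a..b} \<Longrightarrow> square_integrable M (\<lambda>\<omega>. X \<omega> t)"
  using X_measurable X_integrable by (simp add: square_integrable_def)

lemma X_joint: "case_prod X \<in> borel_measurable (M \<Otimes>\<^sub>M K.N)"
proof (rule borel_measurable_LIMSEQ_real)
  define c where "c t = max a (min b t)" for t
  have c: "c t \<in> {a..b}" for t using ab by (auto simp: c_def)
  have c_id: "c t = t" if "t \<in> {a..b}" for t using that by (auto simp: c_def)
  \<comment> \<open>Sample paths are continuous, so they are limits of the paths read off on the grid of mesh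
    \<open>1 / (n + 1)\<close>, where only countably many of the variables \<open>X \<omega> t\<close> occur.\<close>
  let ?F = "\<lambda>n p. X (fst p) (c (real_of_int \<lfloor>snd p * real (Suc n)\<rfloor> / real (Suc n)))"
  show "?F n \<in> borel_measurable (M \<Otimes>\<^sub>M K.N)" for n
  proof (rule measurable_compose_countable[where g = "\<lambda>p. \<lfloor>snd p * real (Suc n)\<rfloor>"])
    show "(\<lambda>p. X (fst p) (c (real_of_int i / real (Suc n)))) \<in> borel_measurable (M \<Otimes>\<^sub>M K.N)" for i
      by (rule measurable_compose[OF measurable_fst X_measurable[OF c]])
    have "(\<lambda>t. t) \<in> measurable K.N borel" by (rule measurable_restrict_space1) simp
    from measurable_compose[OF measurable_snd this]
    have [measurable]: "(\<lambda>p. snd p) \<in> borel_measurable (M \<Otimes>\<^sub>M K.N)" .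
    show "(\<lambda>p. \<lfloor>snd p * real (Suc n)\<rfloor>) \<in> measurable (M \<Otimes>\<^sub>M K.N) (count_space UNIV)"
      by measurable
  qed
  fix p assume "p \<in> space (M \<Otimes>\<^sub>M K.N)"
  then have p: "fst p \<in> space M" "snd p \<in> {a..b}"
    using S_subset by (auto simp: space_pair_measure K.space_N)
  define t where "t = snd p"
  have "(\<lambda>n. real_of_int \<lfloor>t * real (Suc n)\<rfloor> / real (Suc n)) \<longlonglongrightarrow> t"
  proof (rule LIM_zero_cancel, rule Lim_null_comparison)
    have "\<bar>real_of_int \<lfloor>t * real (Suc n)\<rfloor> / real (Suc n) - t\<bar> \<le> 1 / real (Suc n)" for n
    proof -
      have "\<bar>real_of_int \<lfloor>t * real (Suc n)\<rfloor> - t * real (Suc n)\<bar> \<le> 1" by linarith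
      moreover have "real_of_int \<lfloor>t * real (Suc n)\<rfloor> / real (Suc n) - t
          = (real_of_int \<lfloor>t * real (Suc n)\<rfloor> - t * real (Suc n)) / real (Suc n)"
        by (simp add: field_simps)
      ultimately show ?thesis by (simp add: divide_right_mono del: of_nat_Suc)
    qed
    then show "\<forall>\<^sub>F n in sequentially. norm (real_of_int \<lfloor>t * real (Suc n)\<rfloor> / real (Suc n) - t)
        \<le> 1 / real (Suc n)" by simp
    show "(\<lambda>n. 1 / real (Suc n)) \<longlonglongrightarrow> 0" by (rule LIMSEQ_Suc[OF lim_1_over_n])
  qed
  then have "(\<lambda>n. c (real_of_int \<lfloor>t * real (Suc n)\<rfloor> / real (Suc n))) \<longlonglongrightarrow> c t"
    unfolding c_def by (intro tendsto_intros)
  then have "(\<lambda>n. c (real_of_int \<lfloor>t * real (Suc n)\<rfloor> / real (Suc n))) \<longlonglongrightarrow> t"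
    using p by (simp add: c_id t_def)
  from continuous_on_tendsto_compose[OF X_continuous[OF p(1)] this]
  show "(\<lambda>n. ?F n p) \<longlonglongrightarrow> case_prod X p"
    using p c by (simp add: t_def case_prod_unfold del: of_nat_Suc)
qed

lemma second_moment_bounded: "\<exists>B. \<forall>t\<in>{a..b}. (\<integral>\<omega>. (X \<omega> t)\<^sup>2 \<partial>M) \<le> B"
proof -
  obtain B where "\<And>s t. s \<in> {a..b} \<Longrightarrow> t \<in> {a..b} \<Longrightarrow> \<bar>\<gamma> s t\<bar> \<le> B"
    using K.kernel_bounded by blast
  then have "\<gamma> t t \<le> B" if "t \<in> {a..b}" for t using that by (meson abs_le_D1)
  then show ?thesis by (intro exI[of _ B]) (simp add: cov_fun_def power2_eq_square)
qed

lemma X_pair: "square_integrable (M \<Otimes>\<^sub>M K.N) (case_prod X)"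
proof -
  obtain B where B: "\<And>t. t \<in> {a..b} \<Longrightarrow> (\<integral>\<omega>. (X \<omega> t)\<^sup>2 \<partial>M) \<le> B"
    using second_moment_bounded by blast
  show ?thesis
    by (rule square_integrable_pairI[of _ _ _ B])
       (use S_subset in \<open>auto simp: K.space_N subset_iff X_joint intro!: X_integrable B
        sigma_finite_measure_axioms K.N.finite_measure_axioms\<close>)
qed

lemmas Fubini_X = integral_integral_mult_swap[OF sigma_finite_measure_axioms K.N.sigma_finite_measure_axioms X_pair]

lemma eig: "eigen_eq \<gamma> S (lam k) (\<phi> k)" and lam_pos: "0 < lam k"
  and \<phi>_orthonormal: "(\<integral>t. \<phi> j t * \<phi> k t \<partial>K.N) = (if j = k then 1 else 0)"
  using es by (simp_all add: eigensystem_def K.l2_inner_N)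

lemma \<phi>_sq: "square_integrable K.N (\<phi> k)"
  using eig[of k] by (simp add: K.eigen_eq_iff_integral_op)

lemma \<xi>_sq: "square_integrable M (\<xi> k)"
  unfolding \<xi>_eq
  by (rule square_integrable_integral_mult[OF sigma_finite_measure_axioms K.N.sigma_finite_measure_axioms X_pair \<phi>_sq])

text \<open>
  The covariance operator in probabilistic form: it is the covariance of a weighted integral of the
  path with the values of the path.
\<close>

lemma inner_weighted_integral_X:
  assumes f: "square_integrable K.N f" and u: "u \<in> {a..b}"
  shows "(\<integral>\<omega>. (\<integral>t. X \<omega> t * f t \<partial>K.N) * X \<omega> u \<partial>M) = K.integral_op f u"
  unfolding Fubini_X[OF f X_sq[OF u]] by (simp add: K.integral_op_def cov_fun_def mult.commute)

abbreviation \<psi> :: "nat \<Rightarrow> real \<Rightarrow> real" where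
  "\<psi> \<equiv> phi_ext \<gamma> S \<phi> lam"

lemma \<psi>_eq: "\<psi> k u = K.integral_op (\<phi> k) u / lam k"
  by (simp add: phi_ext_def K.l2_inner_N K.integral_op_def mult.commute)

lemma \<psi>_continuous: "continuous_on {a..b} (\<psi> k)"
  unfolding \<psi>_eq using lam_pos[of k] by (intro continuous_intros K.integral_op_continuous \<phi>_sq) simp

lemma inner_\<xi>_X: "u \<in> {a..b} \<Longrightarrow> (\<integral>\<omega>. \<xi> k \<omega> * X \<omega> u \<partial>M) = lam k * \<psi> k u"
  using lam_pos[of k] by (simp add: \<xi>_eq inner_weighted_integral_X[OF \<phi>_sq] \<psi>_eq)

lemma inner_\<xi>_\<xi>: "(\<integral>\<omega>. \<xi> j \<omega> * \<xi> k \<omega> \<partial>M) = (if j = k then lam k else 0)"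
proof -
  have "(\<integral>\<omega>. \<xi> j \<omega> * \<xi> k \<omega> \<partial>M) = (\<integral>t. (\<integral>\<omega>. X \<omega> t * \<xi> k \<omega> \<partial>M) * \<phi> j t \<partial>K.N)"
    unfolding \<xi>_eq[of j] by (rule Fubini_X[OF \<phi>_sq \<xi>_sq])
  also have "\<dots> = (\<integral>t. K.integral_op (\<phi> k) t * \<phi> j t \<partial>K.N)"
  proof (rule Bochner_Integration.integral_cong[OF refl])
    fix t assume "t \<in> space K.N"
    then have "t \<in> {a..b}" using S_subset by (auto simp: K.space_N)
    from inner_weighted_integral_X[OF \<phi>_sq[of k] this]
    show "(\<integral>\<omega>. X \<omega> t * \<xi> k \<omega> \<partial>M) * \<phi> j t = K.integral_op (\<phi> k) t * \<phi> j t"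
      by (simp add: \<xi>_eq mult.commute)
  qed
  also have "\<dots> = lam j * (\<integral>t. \<phi> k t * \<phi> j t \<partial>K.N)" by (rule K.inner_integral_op_eigen[OF eig \<phi>_sq])
  finally show ?thesis by (simp add: \<phi>_orthonormal)
qed

lemma integral_square_\<xi>_sum:
  assumes "finite I"
  shows "(\<integral>\<omega>. (\<Sum>k\<in>I. \<xi> k \<omega> * c k)\<^sup>2 \<partial>M) = (\<Sum>k\<in>I. lam k * (c k)\<^sup>2)"
proof -
  have i: "integrable M (\<lambda>\<omega>. \<xi> j \<omega> * c j * (\<xi> k \<omega> * c k))" for j k
  proof -
    have "integrable M (\<lambda>\<omega>. c j * c k * (\<xi> j \<omega> * \<xi> k \<omega>))"
      by (intro integrable_mult_right integrable_mult_square_integrable \<xi>_sq)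
    then show ?thesis by (simp add: ac_simps)
  qed
  have "(\<integral>\<omega>. \<xi> j \<omega> * c j * (\<xi> k \<omega> * c k) \<partial>M) = (if j = k then lam k * (c k)\<^sup>2 else 0)" for j k
  proof -
    have "(\<integral>\<omega>. \<xi> j \<omega> * c j * (\<xi> k \<omega> * c k) \<partial>M) = (\<integral>\<omega>. c j * c k * (\<xi> j \<omega> * \<xi> k \<omega>) \<partial>M)"
      by (simp add: ac_simps)
    then show ?thesis by (simp add: inner_\<xi>_\<xi> power2_eq_square)
  qed
  then show ?thesis
    using assms i by (simp add: power2_eq_square sum_product Bochner_Integration.integral_sum)
qed

lemma \<xi>_sum_sq: "square_integrable M (\<lambda>\<omega>. \<Sum>k\<in>I. \<xi> k \<omega> * c k)"
  using square_integrable_scale[OF \<xi>_sq] by (intro square_integrable_sum) (simp add: mult.commute)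

lemma recon_sum_X: "recon_sum \<gamma> S \<phi> lam X n \<omega> u = (\<Sum>k<n. \<xi> k \<omega> * \<psi> k u)"
  by (simp add: recon_sum_def \<xi>_def)

lemma bessel:
  assumes u: "u \<in> {a..b}"
  shows "(\<Sum>k<n. lam k * (\<psi> k u)\<^sup>2) \<le> (\<integral>\<omega>. (X \<omega> u)\<^sup>2 \<partial>M)"
proof -
  have "(\<integral>\<omega>. X \<omega> u * (\<Sum>k<n. \<xi> k \<omega> * \<psi> k u) \<partial>M) = (\<integral>\<omega>. (\<Sum>k<n. \<psi> k u * (\<xi> k \<omega> * X \<omega> u)) \<partial>M)"
    by (simp add: sum_distrib_left ac_simps)
  also have "\<dots> = (\<Sum>k<n. \<psi> k u * (lam k * \<psi> k u))"
    using u by (subst Bochner_Integration.integral_sum)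
      (auto simp: inner_\<xi>_X intro!: integrable_mult_right integrable_mult_square_integrable \<xi>_sq X_sq)
  also have "\<dots> = (\<Sum>k<n. lam k * (\<psi> k u)\<^sup>2)" by (simp add: power2_eq_square ac_simps)
  finally have "(\<integral>\<omega>. (X \<omega> u - (\<Sum>k<n. \<xi> k \<omega> * \<psi> k u))\<^sup>2 \<partial>M)
      = (\<integral>\<omega>. (X \<omega> u)\<^sup>2 \<partial>M) - (\<Sum>k<n. lam k * (\<psi> k u)\<^sup>2)"
    unfolding integral_square_diff[OF X_sq[OF u] \<xi>_sum_sq]
    by (simp add: integral_square_\<xi>_sum)
  moreover have "0 \<le> (\<integral>\<omega>. (X \<omega> u - (\<Sum>k<n. \<xi> k \<omega> * \<psi> k u))\<^sup>2 \<partial>M)" by simp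
  ultimately show ?thesis by linarith
qed

lemma recon_sum_X_Cauchy:
  assumes u: "u \<in> {a..b}" and "0 < \<epsilon>"
  shows "\<exists>N. \<forall>m\<ge>N. \<forall>n\<ge>N.
    (\<integral>\<omega>. (recon_sum \<gamma> S \<phi> lam X m \<omega> u - recon_sum \<gamma> S \<phi> lam X n \<omega> u)\<^sup>2 \<partial>M) < \<epsilon>"
proof -
  have le: "(\<integral>\<omega>. (recon_sum \<gamma> S \<phi> lam X m \<omega> u - recon_sum \<gamma> S \<phi> lam X n \<omega> u)\<^sup>2 \<partial>M)
      = (\<Sum>k=n..<m. lam k * (\<psi> k u)\<^sup>2)" if "n \<le> m" for m n
  proof -
    have "recon_sum \<gamma> S \<phi> lam X m \<omega> u - recon_sum \<gamma> S \<phi> lam X n \<omega> u = (\<Sum>k=n..<m. \<xi> k \<omega> * \<psi> k u)" for \<omega>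
      unfolding recon_sum_X using that
      by (simp add: lessThan_atLeast0 sum_diff_nat_ivl)
    then show ?thesis by (simp add: integral_square_\<xi>_sum)
  qed
  have nonneg: "0 \<le> lam k * (\<psi> k u)\<^sup>2" for k using lam_pos[of k] by simp
  have "summable (\<lambda>k. lam k * (\<psi> k u)\<^sup>2)"
    by (rule summableI_nonneg_bounded[OF nonneg bessel[OF u]])
  then obtain N where N: "\<And>m n. N \<le> m \<Longrightarrow> norm (\<Sum>k=m..<n. lam k * (\<psi> k u)\<^sup>2) < \<epsilon>"
    using \<open>0 < \<epsilon>\<close> unfolding summable_Cauchy by blast
  have "(\<integral>\<omega>. (recon_sum \<gamma> S \<phi> lam X m \<omega> u - recon_sum \<gamma> S \<phi> lam X n \<omega> u)\<^sup>2 \<partial>M) < \<epsilon>"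
    if "N \<le> m" "N \<le> n" for m n
  proof (cases "n \<le> m")
    case True
    show ?thesis unfolding le[OF True] using N[OF that(2), of m] by simp
  next
    case False
    then have "(\<integral>\<omega>. (recon_sum \<gamma> S \<phi> lam X n \<omega> u - recon_sum \<gamma> S \<phi> lam X m \<omega> u)\<^sup>2 \<partial>M) < \<epsilon>"
      using le[of m n] N[OF that(1), of n] by simp
    then show ?thesis by (simp add: power2_commute)
  qed
  then show ?thesis by blast
qed

lemmas recon_X = recon_is_ms_limit[OF \<xi>_sq[unfolded \<xi>_def[abs_def]] \<psi>_continuous recon_sum_X_Cauchy]

text \<open>
  Since the scores are orthogonal with variances \<open>lam k\<close> and have covariance \<open>lam k * \<psi> k u\<close> with
  \<open>X(u)\<close>, the reconstruction series is the Fourier series of \<open>X(u)\<close> with respect to them.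
\<close>

lemma recon_X_projection:
  assumes u: "u \<in> {a..b}"
  shows "orth_projection M \<xi> (\<lambda>\<omega>. X \<omega> u) (\<lambda>\<omega>. recon M a b \<gamma> S \<phi> lam X \<omega> u)"
  unfolding orth_projection_def
proof (intro conjI allI impI)
  note lim = recon_X(2)[OF _ _ u, simplified]
  show "square_integrable M (\<lambda>\<omega>. X \<omega> u)" by (rule X_sq[OF u])
  show "square_integrable M (\<lambda>\<omega>. recon M a b \<gamma> S \<phi> lam X \<omega> u)"
    by (rule ms_limit_square_integrable(2)[OF lim])
  have inner: "(\<integral>\<omega>. recon_sum \<gamma> S \<phi> lam X n \<omega> u * W \<omega> \<partial>M)
      = (\<Sum>k<n. (\<integral>\<omega>. W \<omega> * \<xi> k \<omega> \<partial>M) * \<psi> k u)" if W: "square_integrable M W" for W n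
  proof -
    have "(\<integral>\<omega>. recon_sum \<gamma> S \<phi> lam X n \<omega> u * W \<omega> \<partial>M) = (\<integral>\<omega>. (\<Sum>k<n. W \<omega> * \<xi> k \<omega> * \<psi> k u) \<partial>M)"
      by (simp add: recon_sum_X sum_distrib_left sum_distrib_right ac_simps)
    also have "\<dots> = (\<Sum>k<n. \<integral>\<omega>. W \<omega> * \<xi> k \<omega> * \<psi> k u \<partial>M)"
      by (intro Bochner_Integration.integral_sum integrable_mult_left integrable_mult_square_integrable \<xi>_sq W)
    finally show ?thesis by simp
  qed
  show "(\<integral>\<omega>. recon M a b \<gamma> S \<phi> lam X \<omega> u * \<xi> k \<omega> \<partial>M) = (\<integral>\<omega>. X \<omega> u * \<xi> k \<omega> \<partial>M)" for k
  proof (rule LIMSEQ_unique[OF ms_limit_inner[OF lim \<xi>_sq]], rule tendsto_eventually)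
    have "(\<integral>\<omega>. recon_sum \<gamma> S \<phi> lam X n \<omega> u * \<xi> k \<omega> \<partial>M) = (\<integral>\<omega>. X \<omega> u * \<xi> k \<omega> \<partial>M)" if "k < n" for n
    proof -
      have "(\<integral>\<omega>. recon_sum \<gamma> S \<phi> lam X n \<omega> u * \<xi> k \<omega> \<partial>M) = (\<Sum>j<n. if j = k then lam k * \<psi> k u else 0)"
        unfolding inner[OF \<xi>_sq] by (rule sum.cong) (auto simp: inner_\<xi>_\<xi>)
      also have "\<dots> = lam k * \<psi> k u" using that by simp
      finally show ?thesis using inner_\<xi>_X[OF u, of k] by (simp add: mult.commute)
    qed
    then show "\<forall>\<^sub>F n in sequentially. (\<integral>\<omega>. recon_sum \<gamma> S \<phi> lam X n \<omega> u * \<xi> k \<omega> \<partial>M)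
        = (\<integral>\<omega>. X \<omega> u * \<xi> k \<omega> \<partial>M)"
      by (intro eventually_sequentiallyI[of "Suc k"]) simp
  qed
  fix W assume W: "square_integrable M W \<and> (\<forall>k. (\<integral>\<omega>. W \<omega> * \<xi> k \<omega> \<partial>M) = 0)"
  then show "(\<integral>\<omega>. recon M a b \<gamma> S \<phi> lam X \<omega> u * W \<omega> \<partial>M) = 0"
    using ms_limit_inner[OF lim, of W] by (simp add: inner LIMSEQ_const_iff)
qed

lemma X_ms_continuous:
  assumes t: "\<And>n. t n \<in> {a..b}" "t \<longlonglongrightarrow> s" "s \<in> {a..b}"
  shows "ms_limit M (\<lambda>n \<omega>. X \<omega> (t n)) (\<lambda>\<omega>. X \<omega> s)"
proof -
  have \<gamma>_lim: "(\<lambda>n. \<gamma> (f n) (g n)) \<longlonglongrightarrow> \<gamma> s s"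
    if "f \<longlonglongrightarrow> s" "g \<longlonglongrightarrow> s" "\<And>n. f n \<in> {a..b}" "\<And>n. g n \<in> {a..b}" for f g
    using continuous_on_tendsto_compose[OF cov_continuous tendsto_Pair[OF that(1,2)]] that(3,4) t(3)
    by simp
  have "(\<integral>\<omega>. (X \<omega> (t n) - X \<omega> s)\<^sup>2 \<partial>M) = \<gamma> (t n) (t n) - 2 * \<gamma> (t n) s + \<gamma> s s" for n
    using integral_square_diff[OF X_sq[OF t(1)] X_sq[OF t(3)], of n] by (simp add: cov_fun_def power2_eq_square)
  moreover have "(\<lambda>n. \<gamma> (t n) (t n) - 2 * \<gamma> (t n) s + \<gamma> s s) \<longlonglongrightarrow> \<gamma> s s - 2 * \<gamma> s s + \<gamma> s s"
    using t by (intro tendsto_intros \<gamma>_lim) auto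
  ultimately have "(\<lambda>n. \<integral>\<omega>. (X \<omega> (t n) - X \<omega> s)\<^sup>2 \<partial>M) \<longlonglongrightarrow> 0" by simp
  then show ?thesis
    using X_sq[OF t(1)] X_sq[OF t(3)] by (simp add: ms_limit_def square_integrable_def)
qed

text \<open>
  At almost every point of the window \<open>X(t)\<close> lies in the closed span of the scores: the function
  \<open>w t = E(X(t) W)\<close> is orthogonal to every eigenfunction, hence annihilated by the covariance
  operator, and this forces \<open>w = 0\<close> almost everywhere.
\<close>

lemma scores_complete:
  assumes W: "square_integrable M W" and orth: "\<And>k. (\<integral>\<omega>. W \<omega> * \<xi> k \<omega> \<partial>M) = 0"
  shows "AE t in K.N. (\<integral>\<omega>. X \<omega> t * W \<omega> \<partial>M) = 0"
proof -
  define w where "w t = (\<integral>\<omega>. X \<omega> t * W \<omega> \<partial>M)" for t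
  have w: "continuous_on {a..b} w"
    unfolding continuous_on_sequentially w_def comp_def
    using ms_limit_inner[OF X_ms_continuous W] by blast
  note w_sq = K.square_integrable_continuous[OF w]
  have "(\<integral>t. w t * \<phi> k t \<partial>K.N) = 0" for k
    using Fubini_X[OF \<phi>_sq W, of k] orth[of k] by (simp add: w_def \<xi>_eq mult.commute)
  from K.integral_op_zero_of_orthogonal_eigensystem[OF es w this]
  have Tw: "(\<integral>t. (K.integral_op w t)\<^sup>2 \<partial>K.N) = 0" .
  \<comment> \<open>With \<open>w\<close> as weight, \<open>E(Y W)\<close> is the squared norm of \<open>w\<close>, while \<open>E(Y\<^sup>2)\<close> is the quadratic form
    of the covariance operator at \<open>w\<close>, which vanishes.\<close>
  define Y where "Y \<omega> = (\<integral>t. X \<omega> t * w t \<partial>K.N)" for \<omega>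
  have Y_sq: "square_integrable M Y"
    unfolding Y_def
    by (rule square_integrable_integral_mult[OF sigma_finite_measure_axioms K.N.sigma_finite_measure_axioms X_pair w_sq])
  have "(\<integral>\<omega>. (Y \<omega>)\<^sup>2 \<partial>M) = (\<integral>\<omega>. (\<integral>t. X \<omega> t * w t \<partial>K.N) * Y \<omega> \<partial>M)"
    by (simp add: Y_def power2_eq_square)
  also have "\<dots> = (\<integral>t. (\<integral>\<omega>. X \<omega> t * Y \<omega> \<partial>M) * w t \<partial>K.N)"
    by (rule Fubini_X[OF w_sq Y_sq])
  also have "\<dots> = (\<integral>t. K.integral_op w t * w t \<partial>K.N)"
  proof (rule Bochner_Integration.integral_cong[OF refl])
    fix t assume "t \<in> space K.N"
    then have "t \<in> {a..b}" using S_subset by (auto simp: K.space_N)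
    from inner_weighted_integral_X[OF w_sq this]
    show "(\<integral>\<omega>. X \<omega> t * Y \<omega> \<partial>M) * w t = K.integral_op w t * w t" by (simp add: Y_def mult.commute)
  qed
  also have "\<dots> = 0"
    using integral_Cauchy_Schwarz[OF K.integral_op_square_integrable[OF w_sq] w_sq] Tw by simp
  finally have "(\<integral>\<omega>. (Y \<omega>)\<^sup>2 \<partial>M) = 0" .
  then have "(\<integral>\<omega>. Y \<omega> * W \<omega> \<partial>M) = 0"
    using integral_Cauchy_Schwarz[OF Y_sq W] by simp
  moreover have "(\<integral>\<omega>. Y \<omega> * W \<omega> \<partial>M) = (\<integral>t. (w t)\<^sup>2 \<partial>K.N)"
    unfolding Y_def Fubini_X[OF w_sq W] by (simp add: w_def power2_eq_square)
  ultimately have "(\<integral>t. (w t)\<^sup>2 \<partial>K.N) = 0" by simp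
  then have "AE t in K.N. (w t)\<^sup>2 = 0"
    using w_sq by (subst (asm) integral_nonneg_eq_0_iff_AE) (auto simp: square_integrable_def)
  then show ?thesis by eventually_elim (simp add: w_def)
qed

end

section \<open>The two-step reconstruction\<close>

theorem proposition5p1:
  fixes M :: "'w measure"
    and a b u :: real
    and X :: "'w \<Rightarrow> real \<Rightarrow> real"
    and O1 O2 M1 M2 :: "real set"
    and \<phi>1 \<phi>2 :: "nat \<Rightarrow> real \<Rightarrow> real"
    and lam1 lam2 :: "nat \<Rightarrow> real"
  defines "\<gamma> \<equiv> cov_fun M X"
  assumes "prob_space M"
    and "\<And>t. t \<in> {a..b} \<Longrightarrow> (\<lambda>\<omega>. X \<omega> t) \<in> borel_measurable M"
    and "\<And>\<omega>. \<omega> \<in> space M \<Longrightarrow> continuous_on {a..b} (X \<omega>)"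
    and "\<And>t. t \<in> {a..b} \<Longrightarrow> integrable M (\<lambda>\<omega>. (X \<omega> t)\<^sup>2)"
    and "\<And>t. t \<in> {a..b} \<Longrightarrow> (\<integral>\<omega>. X \<omega> t \<partial>M) = 0"
    and "integrable M (\<lambda>\<omega>. l2_norm {a..b} (X \<omega>) ^ 4)"
    and "continuous_on ({a..b} \<times> {a..b}) (\<lambda>(s, t). \<gamma> s t)"
    and "is_interval O1" "O1 \<subseteq> {a..b}" "0 < measure lborel O1"
    and "M1 \<subseteq> {a..b} - O1"
    and "is_interval O2" "O2 \<subseteq> O1 \<union> M1" "0 < measure lborel O2"
    and "M2 \<subseteq> {a..b} - O2" "\<not> M2 \<subseteq> O1 \<union> M1"
    and "eigensystem \<gamma> O1 \<phi>1 lam1"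
    and "eigensystem \<gamma> O2 \<phi>2 lam2"
    and "u \<in> M2"
  shows "(\<integral>\<omega>. (X \<omega> u - recon M a b \<gamma> O2 \<phi>2 lam2
                          (first_step M a b \<gamma> O1 \<phi>1 lam1 M1 X) \<omega> u)\<^sup>2 \<partial>M)
       \<le> (\<integral>\<omega>. (X \<omega> u - recon M a b \<gamma> O2 \<phi>2 lam2 X \<omega> u)\<^sup>2 \<partial>M)
         + (\<integral>\<omega>. (X \<omega> u - recon M a b \<gamma> O1 \<phi>1 lam1 X \<omega> u)\<^sup>2 \<partial>M)"
proof -
  have u: "u \<in> {a..b}" using assms by blast
  have O1: "O1 \<in> sets borel" "O2 \<in> sets borel" "O2 \<subseteq> {a..b}"
    using assms by (auto intro: real_interval_borel_measurable)
  interpret W1: observed_window M X a b O1 \<phi>1 lam1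
    using assms O1 u by (auto simp: observed_window_def observed_window_axioms_def)
  interpret W2: observed_window M X a b O2 \<phi>2 lam2
    using assms O1 u by (auto simp: observed_window_def observed_window_axioms_def)
  define Y where "Y = first_step M a b \<gamma> O1 \<phi>1 lam1 M1 X"
  define R where "R = recon M a b \<gamma> O1 \<phi>1 lam1 X"
  note sf = W1.sigma_finite_measure_axioms W2.K.N.sigma_finite_measure_axioms
  have R_proj: "orth_projection M W1.\<xi> (\<lambda>\<omega>. X \<omega> t) (\<lambda>\<omega>. R \<omega> t)" if "t \<in> {a..b}" for t
    unfolding R_def \<gamma>_def by (rule W1.recon_X_projection[OF that])
  \<comment> \<open>The dummy value of the first step is never seen: every point of \<open>O2\<close> lies in \<open>O1\<close> or in \<open>M1\<close>.\<close>
  have Y_eq: "Y \<omega> t = (if t \<in> O1 then X \<omega> t else R \<omega> t)" if "t \<in> O2" for \<omega> t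
    using that assms(14) by (auto simp: Y_def R_def first_step_def)
  have Y_joint: "case_prod Y \<in> borel_measurable (M \<Otimes>\<^sub>M W2.K.N)"
  proof -
    have [measurable]: "O1 \<in> sets borel" by (rule O1)
    have [measurable]: "(\<lambda>p. X (fst p) (snd p)) \<in> borel_measurable (M \<Otimes>\<^sub>M W2.K.N)"
      using W2.X_joint by (simp add: case_prod_unfold)
    have id: "(\<lambda>t. t) \<in> measurable W2.K.N lborel" by (rule measurable_restrict_space1) simp
    have sndm [measurable]: "(\<lambda>p. snd p) \<in> measurable (M \<Otimes>\<^sub>M W2.K.N) borel"
      using measurable_compose[OF measurable_snd id] by simp
    have Rm: "(\<lambda>p. R (fst p) (snd p)) \<in> borel_measurable (M \<Otimes>\<^sub>M lborel)"
      using W1.recon_X(1) unfolding R_def \<gamma>_def by (simp add: case_prod_unfold)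
    have [measurable]: "(\<lambda>p. R (fst p) (snd p)) \<in> borel_measurable (M \<Otimes>\<^sub>M W2.K.N)"
      using measurable_compose[OF measurable_Pair[OF measurable_fst measurable_compose[OF measurable_snd id]] Rm]
      by simp
    have "(\<lambda>p. if snd p \<in> O1 then X (fst p) (snd p) else R (fst p) (snd p))
        \<in> borel_measurable (M \<Otimes>\<^sub>M W2.K.N)"
      by measurable
    then show ?thesis
      by (rule measurable_cong[THEN iffD1, rotated])
         (auto simp: space_pair_measure W2.K.space_N Y_eq)
  qed
  have Y_sq: "square_integrable M (\<lambda>\<omega>. Y \<omega> t)"
    and Y_le: "(\<integral>\<omega>. (Y \<omega> t)\<^sup>2 \<partial>M) \<le> (\<integral>\<omega>. (X \<omega> t)\<^sup>2 \<partial>M)"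
    and Y_inner: "(\<integral>\<omega>. Y \<omega> t * W1.\<xi> k \<omega> \<partial>M) = (\<integral>\<omega>. X \<omega> t * W1.\<xi> k \<omega> \<partial>M)" if t: "t \<in> O2" for t k
  proof -
    have t': "t \<in> {a..b}" using t O1 by blast
    note p = R_proj[OF t']
    show "square_integrable M (\<lambda>\<omega>. Y \<omega> t)"
      using p W1.X_sq[OF t'] by (cases "t \<in> O1") (auto simp: Y_eq[OF t] orth_projection_def)
    show "(\<integral>\<omega>. (Y \<omega> t)\<^sup>2 \<partial>M) \<le> (\<integral>\<omega>. (X \<omega> t)\<^sup>2 \<partial>M)"
      using orth_projection_contraction[OF W1.\<xi>_sq p] by (cases "t \<in> O1") (simp_all add: Y_eq[OF t])
    show "(\<integral>\<omega>. Y \<omega> t * W1.\<xi> k \<omega> \<partial>M) = (\<integral>\<omega>. X \<omega> t * W1.\<xi> k \<omega> \<partial>M)"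
      using p by (cases "t \<in> O1") (simp_all add: Y_eq[OF t] orth_projection_def)
  qed
  have Y_pair: "square_integrable (M \<Otimes>\<^sub>M W2.K.N) (case_prod Y)"
  proof -
    obtain B where B: "\<And>t. t \<in> {a..b} \<Longrightarrow> (\<integral>\<omega>. (X \<omega> t)\<^sup>2 \<partial>M) \<le> B"
      using W1.second_moment_bounded by blast
    show ?thesis
    proof (rule square_integrable_pairI[OF sf(1) W2.K.N.finite_measure_axioms Y_joint])
      fix t assume "t \<in> space W2.K.N"
      then have t: "t \<in> O2" by (simp add: W2.K.space_N)
      show "integrable M (\<lambda>\<omega>. (Y \<omega> t)\<^sup>2)" using Y_sq[OF t] by (simp add: square_integrable_def)
      show "(\<integral>\<omega>. (Y \<omega> t)\<^sup>2 \<partial>M) \<le> B" using Y_le[OF t] B[of t] t O1 by force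
    qed
  qed
  define \<zeta> where "\<zeta> k \<omega> = l2_inner O2 (Y \<omega>) (\<phi>2 k)" for k \<omega>
  \<comment> \<open>On \<open>O1\<close> the first step keeps \<open>X\<close> itself, which counts as its own projection because the
    scores of \<open>O1\<close> are complete there; on \<open>M1\<close> it is a projection by construction.\<close>
  have \<zeta>_proj: "orth_projection M W1.\<xi> (W2.\<xi> k) (\<zeta> k)" for k
    unfolding \<zeta>_def[abs_def] W2.\<xi>_eq[abs_def] W2.K.l2_inner_N
  proof (rule orth_projection_integral_mult[OF sf W2.X_pair Y_pair W2.\<phi>_sq W1.\<xi>_sq])
    show "(\<integral>\<omega>. Y \<omega> t * W1.\<xi> j \<omega> \<partial>M) = (\<integral>\<omega>. X \<omega> t * W1.\<xi> j \<omega> \<partial>M)" if "t \<in> space W2.K.N" for j t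
      using that by (simp add: W2.K.space_N Y_inner)
    fix W assume W: "square_integrable M W" "\<And>j. (\<integral>\<omega>. W \<omega> * W1.\<xi> j \<omega> \<partial>M) = 0"
    have "AE t in lborel. t \<in> O1 \<longrightarrow> (\<integral>\<omega>. X \<omega> t * W \<omega> \<partial>M) = 0"
      using W1.scores_complete[OF W] by (simp add: W1.K.AE_N)
    then have "AE t in lborel. t \<in> O2 \<longrightarrow> (\<integral>\<omega>. Y \<omega> t * W \<omega> \<partial>M) = 0"
    proof eventually_elim
      case (elim t)
      show ?case
      proof
        assume t: "t \<in> O2"
        then have "(\<integral>\<omega>. R \<omega> t * W \<omega> \<partial>M) = 0"
          using R_proj[of t] W O1 by (auto simp: orth_projection_def)
        with elim show "(\<integral>\<omega>. Y \<omega> t * W \<omega> \<partial>M) = 0" using t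
          by (cases "t \<in> O1") (simp_all add: Y_eq)
      qed
    qed
    then show "AE t in W2.K.N. (\<integral>\<omega>. Y \<omega> t * W \<omega> \<partial>M) = 0" by (simp add: W2.K.AE_N)
  qed
  \<comment> \<open>Projections are linear, so the partial sums of the second step are the projected partial sums
    of the hypothetical reconstruction; as a contraction, the projection also preserves the Cauchy
    property.\<close>
  have sum_proj: "orth_projection M W1.\<xi> (\<lambda>\<omega>. recon_sum \<gamma> O2 \<phi>2 lam2 X n \<omega> v)
      (\<lambda>\<omega>. recon_sum \<gamma> O2 \<phi>2 lam2 Y n \<omega> v)" for n v
  proof -
    have "recon_sum \<gamma> O2 \<phi>2 lam2 X n \<omega> v = (\<Sum>k<n. phi_ext \<gamma> O2 \<phi>2 lam2 k v * W2.\<xi> k \<omega>)"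
      "recon_sum \<gamma> O2 \<phi>2 lam2 Y n \<omega> v = (\<Sum>k<n. phi_ext \<gamma> O2 \<phi>2 lam2 k v * \<zeta> k \<omega>)" for \<omega>
      by (simp_all add: recon_sum_def W2.\<xi>_def \<zeta>_def mult.commute)
    then show ?thesis
      by (simp only:) (intro orth_projection_sum orth_projection_scale W1.\<xi>_sq \<zeta>_proj)
  qed
  have Y_lim: "ms_limit M (\<lambda>n \<omega>. recon_sum \<gamma> O2 \<phi>2 lam2 Y n \<omega> u)
      (\<lambda>\<omega>. recon M a b \<gamma> O2 \<phi>2 lam2 Y \<omega> u)"
  proof (rule W1.recon_is_ms_limit(2))
    show "square_integrable M (\<lambda>\<omega>. l2_inner O2 (Y \<omega>) (\<phi>2 k))" for k
      using \<zeta>_proj[of k] by (simp add: orth_projection_def \<zeta>_def[abs_def])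
    show "continuous_on {a..b} (phi_ext \<gamma> O2 \<phi>2 lam2 k)" for k
      unfolding \<gamma>_def by (rule W2.\<psi>_continuous)
    fix v \<epsilon> :: real assume v: "v \<in> {a..b}" and "0 < \<epsilon>"
    then obtain N where N: "\<And>m n. N \<le> m \<Longrightarrow> N \<le> n \<Longrightarrow>
        (\<integral>\<omega>. (recon_sum \<gamma> O2 \<phi>2 lam2 X m \<omega> v - recon_sum \<gamma> O2 \<phi>2 lam2 X n \<omega> v)\<^sup>2 \<partial>M) < \<epsilon>"
      using W2.recon_sum_X_Cauchy[OF v, of \<epsilon>] unfolding \<gamma>_def by blast
    show "\<exists>N. \<forall>m\<ge>N. \<forall>n\<ge>N.
        (\<integral>\<omega>. (recon_sum \<gamma> O2 \<phi>2 lam2 Y m \<omega> v - recon_sum \<gamma> O2 \<phi>2 lam2 Y n \<omega> v)\<^sup>2 \<partial>M) < \<epsilon>"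
      using orth_projection_contraction[OF W1.\<xi>_sq orth_projection_diff[OF W1.\<xi>_sq sum_proj sum_proj]] N
      by (meson le_less_trans)
  qed (rule u)
  have X_lim: "ms_limit M (\<lambda>n \<omega>. recon_sum \<gamma> O2 \<phi>2 lam2 X n \<omega> u)
      (\<lambda>\<omega>. recon M a b \<gamma> O2 \<phi>2 lam2 X \<omega> u)"
    unfolding \<gamma>_def by (rule W2.recon_X(2)[OF _ _ u]) simp_all
  have "(\<integral>\<omega>. (X \<omega> u - recon M a b \<gamma> O2 \<phi>2 lam2 Y \<omega> u)\<^sup>2 \<partial>M)
      \<le> (\<integral>\<omega>. (X \<omega> u - R \<omega> u)\<^sup>2 \<partial>M) + (\<integral>\<omega>. (X \<omega> u - recon M a b \<gamma> O2 \<phi>2 lam2 X \<omega> u)\<^sup>2 \<partial>M)"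
  proof (rule LIMSEQ_le)
    show "(\<lambda>n. \<integral>\<omega>. (X \<omega> u - recon_sum \<gamma> O2 \<phi>2 lam2 Y n \<omega> u)\<^sup>2 \<partial>M)
        \<longlonglongrightarrow> (\<integral>\<omega>. (X \<omega> u - recon M a b \<gamma> O2 \<phi>2 lam2 Y \<omega> u)\<^sup>2 \<partial>M)"
      by (rule ms_limit_distance[OF Y_lim W1.X_sq[OF u]])
    show "(\<lambda>n. (\<integral>\<omega>. (X \<omega> u - R \<omega> u)\<^sup>2 \<partial>M) + (\<integral>\<omega>. (X \<omega> u - recon_sum \<gamma> O2 \<phi>2 lam2 X n \<omega> u)\<^sup>2 \<partial>M))
        \<longlonglongrightarrow> (\<integral>\<omega>. (X \<omega> u - R \<omega> u)\<^sup>2 \<partial>M) + (\<integral>\<omega>. (X \<omega> u - recon M a b \<gamma> O2 \<phi>2 lam2 X \<omega> u)\<^sup>2 \<partial>M)"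
      by (intro tendsto_intros ms_limit_distance[OF X_lim W1.X_sq[OF u]])
  qed (use orth_projection_error_le[OF W1.\<xi>_sq R_proj[OF u] sum_proj] in blast)
  then show ?thesis by (simp add: Y_def R_def add.commute)
qed

end
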